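(* Let $\lambda$ be an infinite cardinal with $\lambda^{<\lambda}=\lambda$ and suppose $\mathrm{GMA}_{\lambda^+}$ holds. Let $p:[\lambda^+]^2\to\lambda$ be any partition with injective and $\lambda$-almost-disjoint fibers. Then for every coloring $c:[\lambda^+]^2\to\lambda$ there exists a decomposition into pairwise disjoint sets $\lambda^+=\biguplus_{i<\lambda}X_i$ such that for all $i<\lambda$: (i) $X_i$ is $(p,c)$-homogeneous; (ii) if $p$ has in addition $\lambda$-Cohen fibers, then $|X_i|=\lambda^+$ and $p[[X_i]^2]=\lambda$. In particular, $z_p(c)\le\lambda$ for every coloring $c:[\lambda^+]^2\to\lambda$.
   Context: $[A]^2$ denotes pairs $(\alpha,\beta)$ from $A$ with $\alpha<\beta$. For $p:[\kappa]^2\to\mu$: injective fibers means $p(\alpha,\beta)\ne p(\alpha',\beta)$ for $\alpha<\alpha'<\beta$; $\lambda$-almost-disjoint fibers means $|\{p(\alpha,\beta)\mid\alpha<\beta\}\cap\{p(\alpha,\beta')\mid\alpha<\beta\}|<\lambda$ for all $\beta<\beta'<\kappa$; $\lambda$-Cohen fibers means for every injection $g:a\to\mu$ with $a\subseteq\kappa$, $|a|<\lambda$, there are cofinally many $\beta<\kappa$ with $g(\alpha)=p(\alpha,\beta)$ for all $\alpha\in a$. For $p:[\kappa]^2\to\mu$ and $c:[\kappa]^2\to\theta$, a set $A\subseteq\kappa$ is $(p,c)$-homogeneous iff there is $\tau:\mu\to\theta$ with $c(\alpha,\beta)=\tau(p(\alpha,\beta))$ for all $(\alpha,\beta)\in[A]^2$;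 $z_p(c)$ is the least cardinal $\zeta$ such that $\kappa$ is covered by $\zeta$ many $(p,c)$-homogeneous sets. $\mathrm{GMA}_{\lambda^+}$: for every poset $\mathbb Q$ (convention: $q\le r$ means $q$ extends $r$) of size $<2^\lambda$ such that (a) any two compatible conditions have a greatest lower bound, (b) every decreasing sequence of length $\sigma<\lambda$ has a greatest lower bound, (c) $\mathbb Q$ satisfies the $\lambda^+$-stationary chain condition — for every $\langle q_\delta\mid\delta<\lambda^+\rangle$ there are a club $D\subseteq\lambda^+$ and a regressive $h:D\cap E^{\lambda^+}_{\mathrm{cf}(\lambda)}\to\lambda^+$ ($E^{\lambda^+}_{\mathrm{cf}(\lambda)}$ = ordinals below $\lambda^+$ of cofinality $\mathrm{cf}(\lambda)$) such that $h(\gamma)=h(\delta)$ implies $q_\gamma,q_\delta$ compatible — and for every sequence of $\lambda^+$ dense subsets of $\mathbb Q$, there is a filter meeting all of them. *)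

theory Defs
  imports "HOL-Library.FuncSet" "HOL-Library.Disjoint_Sets"
begin

unbundle cardinal_syntax

text \<open>
  Cardinals are the library's cardinal orders: a cardinal \<open>lam\<close> is a relation with
  \<open>Card_order lam\<close>, its elements \<open>\<alpha> < lam\<close> are the members of \<open>Field lam\<close>, and \<open>\<alpha> < \<beta>\<close> is
  \<open>\<alpha> \<in> underS lam \<beta>\<close>.  The successor \<open>lam\<^sup>+\<close> is \<open>cardSuc lam\<close>.
\<close>

definition incr_pairs :: "'k rel \<Rightarrow> 'k set \<Rightarrow> ('k \<times> 'k) set" where
  "incr_pairs \<kappa> A = {(\<alpha>, \<beta>). \<alpha> \<in> A \<and> \<beta> \<in> A \<and> \<alpha> \<in> underS \<kappa> \<beta>}"

definition injective_fibers :: "'k rel \<Rightarrow> ('k \<times> 'k \<Rightarrow> 'm) \<Rightarrow> bool" where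
  "injective_fibers \<kappa> p \<longleftrightarrow>
     (\<forall>\<beta>\<in>Field \<kappa>. \<forall>\<alpha>'\<in>underS \<kappa> \<beta>. \<forall>\<alpha>\<in>underS \<kappa> \<alpha>'. p (\<alpha>, \<beta>) \<noteq> p (\<alpha>', \<beta>))"

definition almost_disjoint_fibers :: "'l rel \<Rightarrow> 'k rel \<Rightarrow> ('k \<times> 'k \<Rightarrow> 'm) \<Rightarrow> bool" where
  "almost_disjoint_fibers lam \<kappa> p \<longleftrightarrow>
     (\<forall>\<beta>'\<in>Field \<kappa>. \<forall>\<beta>\<in>underS \<kappa> \<beta>'.
        |{p (\<alpha>, \<beta>) |\<alpha>. \<alpha> \<in> underS \<kappa> \<beta>} \<inter> {p (\<alpha>, \<beta>') |\<alpha>. \<alpha> \<in> underS \<kappa> \<beta>}| <o lam)"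

text \<open>
  In the next definition \<open>\<alpha> < \<beta>\<close> is explicit because \<open>p (\<alpha>, \<beta>)\<close> is meaningful only then.
\<close>

definition Cohen_fibers :: "'l rel \<Rightarrow> 'k rel \<Rightarrow> 'm rel \<Rightarrow> ('k \<times> 'k \<Rightarrow> 'm) \<Rightarrow> bool" where
  "Cohen_fibers lam \<kappa> \<mu> p \<longleftrightarrow>
     (\<forall>a g. a \<subseteq> Field \<kappa> \<and> |a| <o lam \<and> g \<in> a \<rightarrow> Field \<mu> \<and> inj_on g a \<longrightarrow>
        (\<forall>\<gamma>\<in>Field \<kappa>. \<exists>\<beta>\<in>Field \<kappa>. (\<gamma>, \<beta>) \<in> \<kappa> \<and>
           (\<forall>\<alpha>\<in>a. \<alpha> \<in> underS \<kappa> \<beta> \<and> g \<alpha> = p (\<alpha>, \<beta>))))"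

definition homogeneous ::
    "'k rel \<Rightarrow> 'm rel \<Rightarrow> 't rel \<Rightarrow> ('k \<times> 'k \<Rightarrow> 'm) \<Rightarrow> ('k \<times> 'k \<Rightarrow> 't) \<Rightarrow> 'k set \<Rightarrow> bool" where
  "homogeneous \<kappa> \<mu> \<theta> p c A \<longleftrightarrow>
     A \<subseteq> Field \<kappa> \<and>
     (\<exists>\<tau>\<in>Field \<mu> \<rightarrow> Field \<theta>. \<forall>(\<alpha>, \<beta>)\<in>incr_pairs \<kappa> A. c (\<alpha>, \<beta>) = \<tau> (p (\<alpha>, \<beta>)))"

definition min_card :: "'a set set \<Rightarrow> 'a rel" where
  "min_card S = |SOME A. A \<in> S \<and> (\<forall>B\<in>S. |A| \<le>o |B| )|"

lemma min_card:
  assumes "S \<noteq> {}"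
  shows "\<exists>A\<in>S. min_card S = |A|" and "B \<in> S \<Longrightarrow> min_card S \<le>o |B|"
proof -
  have "\<exists>A. A \<in> S \<and> (\<forall>B\<in>S. |A| \<le>o |B| )"
    using exists_minim_Card_order[of "card_of ` S"] assms by (auto simp: card_of_Card_order)
  then have "(SOME A. A \<in> S \<and> (\<forall>B\<in>S. |A| \<le>o |B| )) \<in> S \<and>
      (\<forall>B\<in>S. |SOME A. A \<in> S \<and> (\<forall>B\<in>S. |A| \<le>o |B| )| \<le>o |B| )"
    by (rule someI_ex)
  then show "\<exists>A\<in>S. min_card S = |A|" and "B \<in> S \<Longrightarrow> min_card S \<le>o |B|"
    unfolding min_card_def by blast+
qed

definition z_num ::
    "'k rel \<Rightarrow> 'm rel \<Rightarrow> 't rel \<Rightarrow> ('k \<times> 'k \<Rightarrow> 'm) \<Rightarrow> ('k \<times> 'k \<Rightarrow> 't) \<Rightarrow> 'k set rel" where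
  "z_num \<kappa> \<mu> \<theta> p c = min_card {\<A>. (\<forall>A\<in>\<A>. homogeneous \<kappa> \<mu> \<theta> p c A) \<and> \<Union>\<A> = Field \<kappa>}"

definition cf :: "'a rel \<Rightarrow> 'a rel" where
  "cf r = min_card {A. A \<subseteq> Field r \<and> (\<forall>x\<in>Field r. \<exists>y\<in>A. (x, y) \<in> r)}"

definition E_cof :: "'k rel \<Rightarrow> 'l rel \<Rightarrow> 'k set" where
  "E_cof \<kappa> \<chi> = {\<delta> \<in> Field \<kappa>. cf (Restr \<kappa> (underS \<kappa> \<delta>)) =o \<chi>}"

definition club :: "'k rel \<Rightarrow> 'k set \<Rightarrow> bool" where
  "club \<kappa> D \<longleftrightarrow>
     D \<subseteq> Field \<kappa> \<and>
     (\<forall>\<alpha>\<in>Field \<kappa>. \<exists>\<beta>\<in>D. \<alpha> \<in> underS \<kappa> \<beta>) \<and>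
     (\<forall>\<delta>\<in>Field \<kappa>. underS \<kappa> \<delta> \<noteq> {} \<and>
        (\<forall>\<alpha>\<in>underS \<kappa> \<delta>. \<exists>\<beta>\<in>D \<inter> underS \<kappa> \<delta>. \<alpha> \<in> underS \<kappa> \<beta>) \<longrightarrow> \<delta> \<in> D)"

text \<open>
  The cardinal \<open>lam\<^bsup><lam\<^esup>\<close> counts functions from some ordinal \<open>\<alpha> < lam\<close> to \<open>lam\<close>.  The disjoint sum
  records the domain \<open>\<alpha>\<close>, which a total function does not determine.
\<close>

definition weak_power :: "'l rel \<Rightarrow> ('l \<times> ('l \<Rightarrow> 'l)) rel" where
  "weak_power lam = |SIGMA \<alpha>:Field lam. Func (underS lam \<alpha>) (Field lam)|"

text \<open>
  A poset is a carrier \<open>Q\<close> with a relation \<open>le\<close>, where \<open>(q, r) \<in> le\<close> means that \<open>q\<close> extends \<open>r\<close>.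
\<close>

definition compatible :: "'q set \<Rightarrow> 'q rel \<Rightarrow> 'q \<Rightarrow> 'q \<Rightarrow> bool" where
  "compatible Q le q r \<longleftrightarrow> (\<exists>s\<in>Q. (s, q) \<in> le \<and> (s, r) \<in> le)"

definition is_glb :: "'q set \<Rightarrow> 'q rel \<Rightarrow> 'q set \<Rightarrow> 'q \<Rightarrow> bool" where
  "is_glb Q le B s \<longleftrightarrow>
     s \<in> Q \<and> (\<forall>b\<in>B. (s, b) \<in> le) \<and> (\<forall>t\<in>Q. (\<forall>b\<in>B. (t, b) \<in> le) \<longrightarrow> (t, s) \<in> le)"

definition dense_in :: "'q set \<Rightarrow> 'q rel \<Rightarrow> 'q set \<Rightarrow> bool" where
  "dense_in Q le D \<longleftrightarrow> D \<subseteq> Q \<and> (\<forall>q\<in>Q. \<exists>d\<in>D. (d, q) \<in> le)"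

definition is_filter_in :: "'q set \<Rightarrow> 'q rel \<Rightarrow> 'q set \<Rightarrow> bool" where
  "is_filter_in Q le G \<longleftrightarrow>
     G \<subseteq> Q \<and> G \<noteq> {} \<and>
     (\<forall>q\<in>G. \<forall>r\<in>Q. (q, r) \<in> le \<longrightarrow> r \<in> G) \<and>
     (\<forall>q\<in>G. \<forall>r\<in>G. \<exists>s\<in>G. (s, q) \<in> le \<and> (s, r) \<in> le)"

definition stationary_cc :: "'l rel \<Rightarrow> 'q set \<Rightarrow> 'q rel \<Rightarrow> bool" where
  "stationary_cc lam Q le \<longleftrightarrow>
     (\<forall>q\<in>Field (cardSuc lam) \<rightarrow> Q. \<exists>D h. club (cardSuc lam) D \<and>
        (\<forall>\<delta>\<in>D \<inter> E_cof (cardSuc lam) (cf lam). h \<delta> \<in> underS (cardSuc lam) \<delta>) \<and>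
        (\<forall>\<gamma>\<in>D \<inter> E_cof (cardSuc lam) (cf lam). \<forall>\<delta>\<in>D \<inter> E_cof (cardSuc lam) (cf lam).
           h \<gamma> = h \<delta> \<longrightarrow> compatible Q le (q \<gamma>) (q \<delta>)))"

definition GMA_poset :: "'l rel \<Rightarrow> 'q set \<Rightarrow> 'q rel \<Rightarrow> bool" where
  "GMA_poset lam Q le \<longleftrightarrow>
     partial_order_on Q le \<and> Q \<noteq> {} \<and> |Q| <o ctwo ^c lam \<and>
     (\<forall>q\<in>Q. \<forall>r\<in>Q. compatible Q le q r \<longrightarrow> (\<exists>s. is_glb Q le {q, r} s)) \<and>
     (\<forall>\<sigma>\<in>Field lam. \<forall>q\<in>underS lam \<sigma> \<rightarrow> Q.
        (\<forall>\<beta>\<in>underS lam \<sigma>. \<forall>\<alpha>\<in>underS lam \<beta>. (q \<beta>, q \<alpha>) \<in> le) \<longrightarrow>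
        (\<exists>s. is_glb Q le (q ` underS lam \<sigma>) s)) \<and>
     stationary_cc lam Q le"

text \<open>
  A poset of size \<open>< 2\<^bsup>lam\<^esup>\<close> has an isomorphic copy with carrier in the type \<open>'l set\<close>, so
  quantifying over posets in that type alone loses no generality; \<open>GMA_any_type\<close> below
  makes this precise.
\<close>

definition GMA :: "'l rel \<Rightarrow> bool" where
  "GMA lam \<longleftrightarrow>
     (\<forall>(Q :: 'l set set) le \<D>. GMA_poset lam Q le \<and>
        (\<forall>\<alpha>\<in>Field (cardSuc lam). dense_in Q le (\<D> \<alpha>)) \<longrightarrow>
        (\<exists>G. is_filter_in Q le G \<and> (\<forall>\<alpha>\<in>Field (cardSuc lam). G \<inter> \<D> \<alpha> \<noteq> {})))"

lemma map_prod_image_iff: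
  assumes "inj_on f Q" "le \<subseteq> Q \<times> Q" "x \<in> Q" "y \<in> Q"
  shows "(f x, f y) \<in> map_prod f f ` le \<longleftrightarrow> (x, y) \<in> le"
proof
  assume "(f x, f y) \<in> map_prod f f ` le"
  then obtain u v where uv: "(u, v) \<in> le" "f x = f u" "f y = f v" by auto
  then have "u \<in> Q" "v \<in> Q" using assms(2) by auto
  then have "x = u" "y = v" using uv assms(1,3,4) by (auto dest: inj_onD)
  then show "(x, y) \<in> le" using uv(1) by simp
qed auto

lemma is_glb_image:
  assumes "inj_on f Q" "B \<subseteq> Q" "is_glb Q le B s" and "le \<subseteq> Q \<times> Q"
  shows "is_glb (f ` Q) (map_prod f f ` le) (f ` B) (f s)"
proof -
  have iff: "(f x, f y) \<in> map_prod f f ` le \<longleftrightarrow> (x, y) \<in> le" if "x \<in> Q" "y \<in> Q" for x y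
    using map_prod_image_iff[OF assms(1,4) that] .
  show ?thesis
    using assms(2,3) iff unfolding is_glb_def by (auto simp: subset_iff)
qed

lemma GMA_any_type:
  fixes lam :: "'l rel" and Q :: "'q set"
  assumes card: "Card_order lam" and gma: "GMA lam" and Q: "GMA_poset lam Q le"
    and dense: "\<And>\<alpha>. \<alpha> \<in> Field (cardSuc lam) \<Longrightarrow> dense_in Q le (\<D> \<alpha>)"
  shows "\<exists>G. is_filter_in Q le G \<and> (\<forall>\<alpha>\<in>Field (cardSuc lam). G \<inter> \<D> \<alpha> \<noteq> {})"
proof -
  have po: "partial_order_on Q le" and lt: "|Q| <o ctwo ^c lam" and ne: "Q \<noteq> {}"
    and ga: "\<And>q r. q \<in> Q \<Longrightarrow> r \<in> Q \<Longrightarrow> compatible Q le q r \<Longrightarrow> \<exists>s. is_glb Q le {q, r} s"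
    and gb: "\<And>\<sigma> q. \<sigma> \<in> Field lam \<Longrightarrow> q \<in> underS lam \<sigma> \<rightarrow> Q \<Longrightarrow>
        (\<forall>\<beta>\<in>underS lam \<sigma>. \<forall>\<alpha>\<in>underS lam \<beta>. (q \<beta>, q \<alpha>) \<in> le) \<Longrightarrow>
        \<exists>s. is_glb Q le (q ` underS lam \<sigma>) s"
    and gc: "stationary_cc lam Q le"
    using Q unfolding GMA_poset_def by auto
  have leQ: "le \<subseteq> Q \<times> Q"
    using po by (simp add: partial_order_on_def preorder_on_def)
  have "|Pow (Field lam)| =o ctwo ^c |Field lam|"
    using card_of_Pow_Func[of "Field lam"]
    unfolding cexp_def ctwo_def Field_card_of by simp
  also have "ctwo ^c |Field lam| =o ctwo ^c lam"
    using cexp_cong2[OF card_of_Field_ordIso[OF card] ctwo_Cnotzero[THEN conjunct2]] card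
    by (simp add: card_of_Card_order)
  finally have "|Q| \<le>o |Pow (Field lam)|"
    using lt ordIso_symmetric ordLess_imp_ordLeq ordLeq_ordIso_trans by blast
  then obtain f :: "'q \<Rightarrow> 'l set" where f: "inj_on f Q"
    unfolding card_of_ordLeq[symmetric] by blast
  define Q' le' where "Q' = f ` Q" and "le' = map_prod f f ` le"
  have iff: "(f x, f y) \<in> le' \<longleftrightarrow> (x, y) \<in> le" if "x \<in> Q" "y \<in> Q" for x y
    unfolding le'_def by (rule map_prod_image_iff[OF f leQ that])
  have comp: "compatible Q' le' (f x) (f y) \<longleftrightarrow> compatible Q le x y" if "x \<in> Q" "y \<in> Q" for x y
    using that iff unfolding compatible_def Q'_def by auto
  have glb: "is_glb Q' le' (f ` B) (f s)" if "B \<subseteq> Q" "is_glb Q le B s" for B s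
    unfolding Q'_def le'_def by (rule is_glb_image[OF f that leQ])
  define g where "g = inv_into Q f"
  have g: "g y \<in> Q" "f (g y) = y" if "y \<in> Q'" for y
    using that unfolding g_def Q'_def by (auto simp: inv_into_into f_inv_into_f)
  have po': "partial_order_on Q' le'"
  proof -
    have "le' \<subseteq> Q' \<times> Q'" using leQ unfolding Q'_def le'_def by auto
    moreover have "refl_on Q' le'"
      using po iff unfolding Q'_def partial_order_on_def preorder_on_def refl_on_def by auto
    moreover have "trans le'"
    proof (rule transI)
      fix x y w assume *: "(x, y) \<in> le'" "(y, w) \<in> le'"
      then have "x \<in> Q'" "y \<in> Q'" "w \<in> Q'" using \<open>le' \<subseteq> Q' \<times> Q'\<close> by auto
      then obtain a b c where "a \<in> Q" "b \<in> Q" "c \<in> Q" "x = f a" "y = f b" "w = f c"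
        unfolding Q'_def by blast
      then show "(x, w) \<in> le'"
        using * iff transD[OF partial_order_onD(2)[OF po], of a b c] by simp
    qed
    moreover have "antisym le'"
    proof (rule antisymI)
      fix x y assume *: "(x, y) \<in> le'" "(y, x) \<in> le'"
      then have "x \<in> Q'" "y \<in> Q'" using \<open>le' \<subseteq> Q' \<times> Q'\<close> by auto
      then obtain a b where "a \<in> Q" "b \<in> Q" "x = f a" "y = f b"
        unfolding Q'_def by blast
      then show "x = y"
        using * iff antisymD[OF partial_order_onD(3)[OF po], of a b] by simp
    qed
    ultimately show ?thesis by (simp add: partial_order_on_def preorder_on_def)
  qed
  have "GMA_poset lam Q' le'"
    unfolding GMA_poset_def
  proof (intro conjI ballI impI)
    show "partial_order_on Q' le'" by (rule po')
    show "Q' \<noteq> {}" using ne by (simp add: Q'_def)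
    show "|Q'| <o ctwo ^c lam"
      using lt card_of_image[of f Q] ordLeq_ordLess_trans unfolding Q'_def by blast
    show "\<exists>s. is_glb Q' le' {q, r} s" if "q \<in> Q'" "r \<in> Q'" "compatible Q' le' q r" for q r
    proof -
      have "g q \<in> Q" "g r \<in> Q" "compatible Q le (g q) (g r)"
        using that g comp[of "g q" "g r"] by simp_all
      then obtain s where "is_glb Q le {g q, g r} s"
        using ga by blast
      then have "is_glb Q' le' (f ` {g q, g r}) (f s)"
        using that g(1) by (intro glb) auto
      then show ?thesis using that g(2) by auto
    qed
    show "\<exists>s. is_glb Q' le' (q ` underS lam \<sigma>) s"
      if "\<sigma> \<in> Field lam" "q \<in> underS lam \<sigma> \<rightarrow> Q'"
        and dec: "\<forall>\<beta>\<in>underS lam \<sigma>. \<forall>\<alpha>\<in>underS lam \<beta>. (q \<beta>, q \<alpha>) \<in> le'" for \<sigma> q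
    proof -
      have tr: "\<alpha> \<in> underS lam \<sigma>" if "\<beta> \<in> underS lam \<sigma>" "\<alpha> \<in> underS lam \<beta>" for \<alpha> \<beta>
      proof -
        have "Partial_order lam"
          using card unfolding card_order_on_def well_order_on_def linear_order_on_def by blast
        then have "trans lam" "antisym lam" by (rule partial_order_onD)+
        then show ?thesis
          using that transD[of lam \<alpha> \<beta> \<sigma>] antisymD[of lam \<alpha> \<beta>] unfolding underS_def by auto
      qed
      have in_Q: "(g \<circ> q) \<in> underS lam \<sigma> \<rightarrow> Q" using that(2) g(1) by (simp add: Pi_iff)
      moreover have "\<forall>\<beta>\<in>underS lam \<sigma>. \<forall>\<alpha>\<in>underS lam \<beta>. ((g \<circ> q) \<beta>, (g \<circ> q) \<alpha>) \<in> le"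
      proof (intro ballI)
        fix \<beta> \<alpha> assume b: "\<beta> \<in> underS lam \<sigma>" and a: "\<alpha> \<in> underS lam \<beta>"
        have "q \<beta> \<in> Q'" "q \<alpha> \<in> Q'" using that(2) b tr[OF b a] by (simp_all add: Pi_iff)
        then show "((g \<circ> q) \<beta>, (g \<circ> q) \<alpha>) \<in> le"
          using dec b a g iff[of "g (q \<beta>)" "g (q \<alpha>)"] by simp
      qed
      ultimately have "\<exists>s. is_glb Q le ((g \<circ> q) ` underS lam \<sigma>) s"
        by (rule gb[OF that(1)])
      then obtain s where "is_glb Q le ((g \<circ> q) ` underS lam \<sigma>) s" by blast
      then have "is_glb Q' le' (f ` (g \<circ> q) ` underS lam \<sigma>) (f s)"
        using in_Q by (intro glb) auto
      moreover have "f ` (g \<circ> q) ` underS lam \<sigma> = q ` underS lam \<sigma>"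
        unfolding image_image using that(2) g(2) by (intro image_cong) auto
      ultimately show ?thesis by auto
    qed
    show "stationary_cc lam Q' le'"
      unfolding stationary_cc_def
    proof (intro ballI)
      let ?K = "cardSuc lam" let ?E = "E_cof (cardSuc lam) (cf lam)"
      fix q assume q: "q \<in> Field ?K \<rightarrow> Q'"
      then have "(g \<circ> q) \<in> Field ?K \<rightarrow> Q" using g(1) by (simp add: Pi_iff)
      from bspec[OF gc[unfolded stationary_cc_def] this] obtain D h where D: "club ?K D"
        and h: "\<forall>\<delta>\<in>D \<inter> ?E. h \<delta> \<in> underS ?K \<delta>"
          "\<forall>\<gamma>\<in>D \<inter> ?E. \<forall>\<delta>\<in>D \<inter> ?E. h \<gamma> = h \<delta> \<longrightarrow> compatible Q le ((g \<circ> q) \<gamma>) ((g \<circ> q) \<delta>)"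
        by (elim exE conjE)
      have "compatible Q' le' (q \<gamma>) (q \<delta>)"
        if "\<gamma> \<in> D \<inter> ?E" "\<delta> \<in> D \<inter> ?E" "h \<gamma> = h \<delta>" for \<gamma> \<delta>
      proof -
        have "q \<gamma> \<in> Q'" "q \<delta> \<in> Q'" using that q by (simp_all add: E_cof_def Pi_iff)
        then show ?thesis
          using h(2)[rule_format, OF that] comp[of "g (q \<gamma>)" "g (q \<delta>)"] g by simp
      qed
      then show "\<exists>D h. club ?K D \<and> (\<forall>\<delta>\<in>D \<inter> ?E. h \<delta> \<in> underS ?K \<delta>) \<and>
          (\<forall>\<gamma>\<in>D \<inter> ?E. \<forall>\<delta>\<in>D \<inter> ?E. h \<gamma> = h \<delta> \<longrightarrow> compatible Q' le' (q \<gamma>) (q \<delta>))"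
        using D h(1) by (intro exI[of _ D] exI[of _ h]) simp
    qed
  qed
  moreover have "\<forall>\<alpha>\<in>Field (cardSuc lam). dense_in Q' le' (f ` \<D> \<alpha>)"
  proof
    fix \<alpha> assume "\<alpha> \<in> Field (cardSuc lam)"
    from dense[OF this] have D: "\<D> \<alpha> \<subseteq> Q" "\<And>q. q \<in> Q \<Longrightarrow> \<exists>d\<in>\<D> \<alpha>. (d, q) \<in> le"
      unfolding dense_in_def by auto
    show "dense_in Q' le' (f ` \<D> \<alpha>)"
      unfolding dense_in_def
    proof (intro conjI ballI)
      show "f ` \<D> \<alpha> \<subseteq> Q'" using D(1) unfolding Q'_def by auto
      fix y assume "y \<in> Q'"
      then obtain q where "q \<in> Q" "y = f q" unfolding Q'_def by blast
      moreover obtain d where "d \<in> \<D> \<alpha>" "(d, q) \<in> le" using D(2)[OF \<open>q \<in> Q\<close>] by blast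
      ultimately show "\<exists>d\<in>f ` \<D> \<alpha>. (d, y) \<in> le'"
        using D(1) iff[of d q] by blast
    qed
  qed
  ultimately have "\<exists>G. is_filter_in Q' le' G \<and> (\<forall>\<alpha>\<in>Field (cardSuc lam). G \<inter> f ` \<D> \<alpha> \<noteq> {})"
    using gma[unfolded GMA_def, rule_format, of Q' le' "\<lambda>\<alpha>. f ` \<D> \<alpha>"] by simp
  then obtain G where G: "is_filter_in Q' le' G"
    and meet: "\<And>\<alpha>. \<alpha> \<in> Field (cardSuc lam) \<Longrightarrow> G \<inter> f ` \<D> \<alpha> \<noteq> {}"
    by blast
  define H where "H = {x \<in> Q. f x \<in> G}"
  have GH: "G = f ` H" using G unfolding H_def is_filter_in_def Q'_def by auto
  have "is_filter_in Q le H"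
    unfolding is_filter_in_def
  proof (intro conjI ballI impI)
    show "H \<subseteq> Q" by (auto simp: H_def)
    show "H \<noteq> {}" using G GH by (auto simp: is_filter_in_def)
    show "r \<in> H" if "q \<in> H" "r \<in> Q" "(q, r) \<in> le" for q r
      using that G iff[of q r] unfolding H_def is_filter_in_def Q'_def by blast
    show "\<exists>s\<in>H. (s, q) \<in> le \<and> (s, r) \<in> le" if "q \<in> H" "r \<in> H" for q r
    proof -
      have "f q \<in> G" "f r \<in> G" using that by (simp_all add: H_def)
      then have "\<exists>t\<in>G. (t, f q) \<in> le' \<and> (t, f r) \<in> le'"
        using G unfolding is_filter_in_def by simp
      then obtain t where t: "t \<in> G" "(t, f q) \<in> le'" "(t, f r) \<in> le'" by blast
      then obtain s where s: "s \<in> H" "t = f s" using GH by blast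
      with t that have "(s, q) \<in> le" "(s, r) \<in> le" using iff unfolding H_def by auto
      with s show ?thesis by blast
    qed
  qed
  moreover have "H \<inter> \<D> \<alpha> \<noteq> {}" if "\<alpha> \<in> Field (cardSuc lam)" for \<alpha>
    using meet[OF that] dense[OF that] unfolding H_def dense_in_def by blast
  ultimately show ?thesis by blast
qed

end

theory Submission
  imports Defs
begin

text \<open>
  Force with partial functions \<open>f\<close> from \<open>lam\<^sup>+\<close> to \<open>lam\<close> of size \<open>< lam\<close> all of whose colour classes
  are \<open>(p, c)\<close>-homogeneous; a generic filter yields the decomposition.  For the chain condition, let
  \<open>f\<close> and \<open>g\<close> be the conditions with indices \<open>gam < del\<close>, which agree below \<open>gam\<close> and \<open>del\<close>
  respectively and impose the same constraints, with \<open>f\<close> living below \<open>del\<close>.  By injectivity and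
  almost disjointness of the fibers, fewer than \<open>lam\<close> ordinals \<open>x < del\<close> have the property that some
  \<open>p (x, y)\<close> with \<open>y \<ge> del\<close> in the domain of \<open>g\<close> is already a constrained value or is also attained
  on another such fiber.  As \<open>del\<close> has cofinality \<open>lam\<close> these \<open>x\<close> are bounded below \<open>del\<close>, and if the bound is
  also below \<open>gam\<close> then \<open>f \<union> g\<close> is a condition.  The poset has size \<open>lam\<^sup>+\<close>, which is below
  \<open>2\<^bsup>lam\<^esup>\<close> because the axiom applies to Cohen forcing.  With Cohen fibers, a condition can be extended
  by an arbitrarily large point whose values on its domain are prescribed, which gives the remaining
  density arguments.
\<close>

section \<open>Well-orders and cardinals\<close>

lemma underS_trans:
  assumes "Well_order r" "x \<in> underS r y" "y \<in> underS r z"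
  shows "x \<in> underS r z"
proof -
  have "trans r" "antisym r"
    using assms(1) by (auto simp: order_on_defs)
  then show ?thesis
    using assms(2,3) unfolding underS_def by (auto dest: transD antisymD)
qed

lemma underS_linear:
  assumes "Well_order r" "x \<in> Field r" "y \<in> Field r"
  shows "x \<in> underS r y \<or> x = y \<or> y \<in> underS r x"
  using assms unfolding order_on_defs total_on_def underS_def by auto

lemma underS_asym:
  assumes "Well_order r" "x \<in> underS r y"
  shows "y \<notin> underS r x"
  using underS_trans[OF assms(1), of x y x] assms(2) underS_notIn by fast

lemma underS_in_Field:
  assumes "x \<in> underS r y" shows "x \<in> Field r" "y \<in> Field r"
  using assms by (auto simp: underS_def Field_def)

lemma Well_order_mem_iff:
  assumes "Well_order r" "x \<in> Field r" "y \<in> Field r"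
  shows "(x, y) \<in> r \<longleftrightarrow> y \<notin> underS r x"
proof -
  have "antisym r" "\<And>x. x \<in> Field r \<Longrightarrow> (x, x) \<in> r"
    using assms(1) by (auto simp: order_on_defs refl_on_def)
  with underS_linear[OF assms] assms(2,3) show ?thesis
    unfolding underS_def by (auto dest: antisymD)
qed

lemma ex_minimal_underS:
  assumes "Well_order r" "S \<subseteq> Field r" "S \<noteq> {}"
  obtains m where "m \<in> S" "\<And>x. x \<in> underS r m \<Longrightarrow> x \<notin> S"
proof -
  have "wf (r - Id)" using assms(1) by (simp add: well_order_on_def)
  then obtain m where "m \<in> S" "\<And>y. (y, m) \<in> r - Id \<Longrightarrow> y \<notin> S"
    using assms(3) by (metis ex_in_conv wfE_min)
  then show ?thesis using that unfolding underS_def by auto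
qed

lemma card_image_ordLess: "|A| <o r \<Longrightarrow> |f ` A| <o r"
  using card_of_image ordLeq_ordLess_trans by blast

lemma card_subset_ordLess: "A \<subseteq> B \<Longrightarrow> |B| <o r \<Longrightarrow> |A| <o r"
  using card_of_mono1 ordLeq_ordLess_trans by blast

lemma card_image_ordLeq: "|A| \<le>o r \<Longrightarrow> |f ` A| \<le>o r"
  using card_of_image ordLeq_transitive by blast

lemma card_subset_ordLeq: "A \<subseteq> B \<Longrightarrow> |B| \<le>o r \<Longrightarrow> |A| \<le>o r"
  using card_of_mono1 ordLeq_transitive by blast

lemma card_inj_ordLess:
  assumes "inj_on f A" "f ` A \<subseteq> B" "|B| <o r" shows "|A| <o r"
  using assms card_of_ordLeq[of A B] ordLeq_ordLess_trans by blast

definition small_subsets :: "'l rel \<Rightarrow> 'b set \<Rightarrow> 'b set set" where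
  "small_subsets lam B = {S. S \<subseteq> B \<and> |S| <o lam}"

section \<open>Cardinal arithmetic at \<open>lam\<close> and its successor\<close>

locale infinite_cardinal =
  fixes lam :: "'a rel"
  assumes Card: "Card_order lam" and inf: "cinfinite lam"
begin

abbreviation "L \<equiv> Field lam"
abbreviation "kap \<equiv> cardSuc lam"
abbreviation "K \<equiv> Field (cardSuc lam)"

lemma infL: "infinite L"
  using inf by (simp add: cinfinite_def)

lemma wo_lam: "Well_order lam"
  using Card by (simp add: card_order_on_def)

lemma Card_kap: "Card_order kap"
  using Card by (rule cardSuc_Card_order)

lemma wo_kap: "Well_order kap"
  using Card_kap by (simp add: card_order_on_def)

lemma infK: "infinite K"
  using Card infL by (simp add: cardSuc_finite)

lemma card_L: "|L| =o lam" and card_K: "|K| =o kap"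
  using Card Card_kap by (simp_all add: card_of_Field_ordIso)

lemma finite_small: "finite A \<Longrightarrow> |A| <o lam"
  using finite_ordLess_infinite[of "|A|" lam] infL wo_lam card_of_Well_order
  by (auto simp: Field_card_of)

lemma small_imp_ordLeq: "|A| <o lam \<Longrightarrow> |A| \<le>o lam"
  by (rule ordLess_imp_ordLeq)

lemma small_Un: "|A| <o lam \<Longrightarrow> |B| <o lam \<Longrightarrow> |A \<union> B| <o lam"
  using card_of_Un_ordLess_infinite_Field infL Card by blast

lemma ordLeq_kap_UN:
  assumes "|I| \<le>o kap" "\<And>i. i \<in> I \<Longrightarrow> |A i| \<le>o kap" shows "|\<Union>i\<in>I. A i| \<le>o kap"
  using card_of_Sigma_ordLeq_infinite_Field[OF infK Card_kap, of I A] assms card_of_UNION_Sigma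
    ordLeq_transitive by blast

lemma card_underS_kap: "|underS kap x| \<le>o lam"
proof (cases "x \<in> K")
  case True
  then have "|underS kap x| <o kap" by (intro card_of_underS Card_kap)
  then show ?thesis using Card card_of_Card_order cardSuc_ordLeq_ordLess by blast
next
  case False
  then show ?thesis using finite_small[of "underS kap x"] by (simp add: underS_empty small_imp_ordLeq)
qed

lemma small_not_onto:
  assumes "|A| <o lam" obtains x where "x \<in> L" "x \<notin> A"
proof -
  have "\<not> L \<subseteq> A"
    using card_subset_ordLess[of L A lam] assms card_L not_ordLess_ordIso by blast
  then show ?thesis using that by blast
qed

text \<open>A successor cardinal is regular, so \<open>B\<close> is not cofinal and some
  \<open>a\<close> has no member of \<open>B\<close> strictly above it. Since \<open>kap\<close> has
  no last element, a step beyond \<open>a\<close> makes the bound strict.\<close>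

lemma bounded_in_kap:
  assumes "B \<subseteq> K" "|B| \<le>o lam"
  obtains x where "x \<in> K" "B \<subseteq> underS kap x"
proof -
  have "\<not> |B| =o kap"
    using assms(2) Card cardSuc_greater not_ordLess_ordIso ordLeq_ordLess_trans by blast
  then have "\<not> cofinal B kap"
    using infinite_cardSuc_regularCard[OF infL Card] assms(1) unfolding regularCard_def by blast
  then obtain a where a: "a \<in> K" "\<And>b. b \<in> B \<Longrightarrow> a \<notin> underS kap b"
    unfolding cofinal_def underS_def by blast
  obtain x where x: "x \<in> K" "a \<in> underS kap x"
    using infinite_Card_order_limit[OF Card_kap infK a(1)] unfolding underS_def by blast
  have "b \<in> underS kap x" if "b \<in> B" for b
    using underS_linear[OF wo_kap, of a b] a that assms(1) x underS_trans[OF wo_kap] by blast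
  then show ?thesis using that x by blast
qed

text \<open>A cardinal below \<open>lam\<close> is isomorphic to a proper initial segment of
  \<open>lam\<close>. This presents small sets as ranges of the functions that
  \<open>weak_power\<close> counts.\<close>

lemma small_subset_enumeration:
  assumes "|S| <o lam"
  obtains a f where "a \<in> L" "f \<in> underS lam a \<rightarrow> S" "f ` underS lam a = S"
proof -
  obtain a where a: "a \<in> L" "|S| =o Restr lam (underS lam a)"
    using assms ordLess_iff_ordIso_Restr[OF wo_lam card_of_Well_order] by blast
  moreover have "Field (Restr lam (underS lam a)) = underS lam a"
    using wo_lam underS_Field by (intro Refl_Field_Restr2) (auto simp: order_on_defs)
  ultimately have "|underS lam a| =o |S|"
    using card_of_cong[OF a(2)] by (simp add: Field_card_of ordIso_symmetric)
  then obtain f where "bij_betw f (underS lam a) S"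
    unfolding card_of_ordIso[symmetric] by blast
  then show ?thesis using that[OF a(1), of f] by (auto simp: bij_betw_def)
qed

section \<open>Club sets and coding by regressive functions\<close>

text \<open>For unboundedness, let \<open>G x\<close> lie above \<open>x\<close> and all values of
  \<open>F\<close> at points up to \<open>x\<close>. The least strict upper bound of the countable
  orbit of \<open>a\<close> under \<open>G\<close> is then closed under \<open>F\<close>.\<close>

lemma club_closure_points:
  assumes F: "\<And>x. x \<in> K \<Longrightarrow> F x \<in> K"
  shows "club kap {d \<in> K. \<forall>x\<in>underS kap d. F x \<in> underS kap d}" (is "club kap ?D")
  unfolding club_def
proof (intro conjI ballI impI)
  show "?D \<subseteq> K" by blast
next
  fix a assume a: "a \<in> K"
  have "\<exists>y\<in>K. insert x (F ` insert x (underS kap x)) \<subseteq> underS kap y" if "x \<in> K" for x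
  proof -
    let ?B = "{x, F x} \<union> F ` underS kap x"
    have "|?B| \<le>o lam"
      using card_underS_kap[of x] card_image_ordLeq small_imp_ordLeq finite_small[of "{x, F x}"]
      by (intro card_of_Un_ordLeq_infinite_Field[OF infL _ _ Card]) auto
    moreover have "?B \<subseteq> K"
      using that F underS_in_Field(1) by fast
    ultimately obtain y where "y \<in> K" "?B \<subseteq> underS kap y"
      using bounded_in_kap by blast
    then show ?thesis by (intro bexI[of _ y]) auto
  qed
  then obtain G where G: "\<And>x. x \<in> K \<Longrightarrow> G x \<in> K"
      "\<And>x. x \<in> K \<Longrightarrow> insert x (F ` insert x (underS kap x)) \<subseteq> underS kap (G x)"
    by metis
  define s where "s n = (G ^^ n) a" for n
  have s: "s n \<in> K" for n by (induction n) (auto simp: s_def a G)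
  have sS: "s (Suc n) = G (s n)" for n by (simp add: s_def)
  have "|range s| \<le>o lam"
  proof (rule card_image_ordLeq)
    show "|UNIV :: nat set| \<le>o lam"
      using infL card_L ordLeq_ordIso_trans unfolding infinite_iff_card_of_nat by blast
  qed
  then obtain z where z: "z \<in> K" "range s \<subseteq> underS kap z"
    using bounded_in_kap[of "range s"] s by blast
  \<comment> \<open>By minimality a point below \<open>d\<close> fails to bound the orbit, so it
    lies at or below some \<open>s n\<close>, and its value under \<open>F\<close> lies below
    \<open>s (Suc n)\<close>.\<close>
  obtain d where d: "d \<in> {z\<in>K. range s \<subseteq> underS kap z}"
      "\<And>x. x \<in> underS kap d \<Longrightarrow> x \<notin> {z\<in>K. range s \<subseteq> underS kap z}"
    using ex_minimal_underS[OF wo_kap, of "{z\<in>K. range s \<subseteq> underS kap z}"] z by auto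
  have "F x \<in> underS kap d" if x: "x \<in> underS kap d" for x
  proof -
    obtain n where "s n \<notin> underS kap x"
      using d(2)[OF x] underS_in_Field(1)[OF x] by blast
    then have "x \<in> insert (s n) (underS kap (s n))"
      using underS_linear[OF wo_kap, of x "s n"] underS_in_Field(1)[OF x] s by blast
    then have "F x \<in> underS kap (s (Suc n))" using G(2)[OF s, of n] sS by auto
    then show ?thesis using d(1) underS_trans[OF wo_kap] by blast
  qed
  moreover have "a \<in> underS kap d"
  proof -
    have "s 0 \<in> underS kap d" using d(1) by blast
    then show ?thesis by (simp add: s_def)
  qed
  ultimately show "\<exists>b\<in>?D. a \<in> underS kap b"
    using d(1) by blast
next
  fix d assume "d \<in> K"
    and "underS kap d \<noteq> {} \<and> (\<forall>a\<in>underS kap d. \<exists>b\<in>?D \<inter> underS kap d. a \<in> underS kap b)"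
  then show "d \<in> ?D" using underS_trans[OF wo_kap] by blast
qed

text \<open>All codes together inject into \<open>kap\<close> by \<open>e\<close>. At club many
  \<open>d\<close> the codes from \<open>C x\<close> with \<open>x\<close> below \<open>d\<close>
  land below \<open>d\<close>, so \<open>e \<circ> co\<close> is regressive and still determines
  \<open>co\<close>. The same club is made closed under a prescribed \<open>F\<close>.\<close>

lemma regressive_coding:
  assumes F: "\<And>x. x \<in> K \<Longrightarrow> F x \<in> K"
    and C: "\<And>x. x \<in> K \<Longrightarrow> |C x| \<le>o lam"
    and rho: "\<And>d. d \<in> E \<Longrightarrow> rho d \<in> underS kap d"
    and co: "\<And>d. d \<in> E \<Longrightarrow> co d \<in> C (rho d)"
  shows "\<exists>D h. club kap D \<and> (\<forall>d\<in>D. \<forall>x\<in>underS kap d. F x \<in> underS kap d) \<and>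
    (\<forall>d\<in>D \<inter> E. h d \<in> underS kap d) \<and>
    (\<forall>g\<in>D \<inter> E. \<forall>d\<in>D \<inter> E. h g = h d \<longrightarrow> co g = co d)"
proof -
  have "|\<Union>x\<in>K. C x| \<le>o kap"
    using C card_K cardSuc_ordLeq[OF Card] ordLeq_transitive
    by (intro ordLeq_kap_UN) (auto intro: ordIso_imp_ordLeq)
  then have "|\<Union>x\<in>K. C x| \<le>o |K|"
    using card_K ordIso_symmetric ordLeq_ordIso_trans by blast
  then obtain e where e: "inj_on e (\<Union>x\<in>K. C x)" "e ` (\<Union>x\<in>K. C x) \<subseteq> K"
    unfolding card_of_ordLeq[symmetric] by blast
  have "\<exists>y\<in>K. insert (F x) (e ` C x) \<subseteq> underS kap y" if "x \<in> K" for x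
  proof -
    have "|{F x} \<union> e ` C x| \<le>o lam"
      using C[OF that] card_image_ordLeq small_imp_ordLeq finite_small[of "{F x}"]
      by (intro card_of_Un_ordLeq_infinite_Field[OF infL _ _ Card]) auto
    moreover have "{F x} \<union> e ` C x \<subseteq> K" using that F e(2) by blast
    ultimately obtain y where "y \<in> K" "{F x} \<union> e ` C x \<subseteq> underS kap y"
      using bounded_in_kap by blast
    then show ?thesis by (intro bexI[of _ y]) auto
  qed
  then obtain G where G: "\<And>x. x \<in> K \<Longrightarrow> G x \<in> K"
      "\<And>x. x \<in> K \<Longrightarrow> insert (F x) (e ` C x) \<subseteq> underS kap (G x)"
    by metis
  define D where "D = {d \<in> K. \<forall>x\<in>underS kap d. G x \<in> underS kap d}"
  show ?thesis
  proof (intro exI[of _ D] exI[of _ "e \<circ> co"] conjI ballI impI)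
    show "club kap D" unfolding D_def by (rule club_closure_points) (rule G(1))
    show "F x \<in> underS kap d" if "d \<in> D" "x \<in> underS kap d" for d x
      using that G(2)[OF underS_in_Field(1)[OF that(2)]] underS_trans[OF wo_kap] unfolding D_def
      by blast
    show "(e \<circ> co) d \<in> underS kap d" if "d \<in> D \<inter> E" for d
    proof -
      have r: "rho d \<in> underS kap d" "co d \<in> C (rho d)" using that rho co by blast+
      then have "e (co d) \<in> underS kap (G (rho d))"
        using G(2)[OF underS_in_Field(1)[OF r(1)]] by blast
      moreover have "G (rho d) \<in> underS kap d" using that r unfolding D_def by blast
      ultimately show ?thesis using underS_trans[OF wo_kap] by auto
    qed
    show "co g = co d" if "g \<in> D \<inter> E" "d \<in> D \<inter> E" "(e \<circ> co) g = (e \<circ> co) d" for g d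
    proof -
      have "co x \<in> (\<Union>x\<in>K. C x)" if "x \<in> E" for x
        using co[OF that] underS_in_Field(1)[OF rho[OF that]] by blast
      then have "co g \<in> (\<Union>x\<in>K. C x)" "co d \<in> (\<Union>x\<in>K. C x)"
        using that by blast+
      then show ?thesis using e(1) that(3) by (auto dest: inj_onD)
    qed
  qed
qed

end

section \<open>Consequences of the weak power hypothesis\<close>

locale weak_power_cardinal = infinite_cardinal +
  assumes wp: "weak_power lam =o lam"
begin

text \<open>Diagonalising against an enumeration of the functions from a short cofinal set.\<close>

lemma cofinal_not_small:
  assumes A: "A \<subseteq> L" "\<And>x. x \<in> L \<Longrightarrow> \<exists>y\<in>A. (x, y) \<in> lam"
  shows "\<not> |A| <o lam"
proof
  assume "|A| <o lam"
  then obtain a f where a: "a \<in> L" and f: "f \<in> underS lam a \<rightarrow> A" "f ` underS lam a = A"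
    using small_subset_enumeration by blast
  let ?F = "Func (underS lam a) L"
  \<comment> \<open>The tag \<open>a\<close> places the functions on this one segment inside the
    disjoint sum counted by \<open>weak_power\<close>.\<close>
  have "Pair a ` ?F \<subseteq> (SIGMA \<alpha>:L. Func (underS lam \<alpha>) L)" using a by auto
  then have "|Pair a ` ?F| \<le>o |L|"
    using wp card_L unfolding weak_power_def
    by (metis card_of_mono1 ordIso_symmetric ordIso_transitive ordLeq_ordIso_trans)
  moreover have "|?F| =o |Pair a ` ?F|"
    by (intro card_of_ordIsoI[of "Pair a"]) (auto simp: bij_betw_def inj_on_def)
  ultimately have "|?F| \<le>o |L|" using ordIso_ordLeq_trans by blast
  moreover have ne: "?F \<noteq> {}" using a by (intro Func_non_emp) auto
  ultimately obtain G where G: "G ` L = ?F" unfolding card_of_ordLeq2[OF ne, symmetric] by blast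
  \<comment> \<open>At coordinate \<open>b\<close> only the functions \<open>G x\<close> with
    \<open>x\<close> up to \<open>f b\<close> have to be avoided, and these are fewer than
    \<open>lam\<close>. Every \<open>x\<close> is dealt with at some coordinate because
    \<open>A\<close> is cofinal.\<close>
  have "\<exists>z\<in>L. \<forall>x\<in>L. (x, f b) \<in> lam \<longrightarrow> G x b \<noteq> z" if b: "b \<in> underS lam a" for b
  proof -
    have fb: "f b \<in> L" using f b A(1) by blast
    have "|insert (f b) (underS lam (f b))| <o lam"
      using small_Un[OF finite_small[of "{f b}"] card_of_underS[OF Card fb]] by simp
    then have "|(\<lambda>x. G x b) ` insert (f b) (underS lam (f b))| <o lam"
      by (rule card_image_ordLess)
    then obtain z where "z \<in> L" "z \<notin> (\<lambda>x. G x b) ` insert (f b) (underS lam (f b))"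
      using small_not_onto by blast
    moreover have "x \<in> insert (f b) (underS lam (f b))" if "(x, f b) \<in> lam" for x
      using that unfolding underS_def by blast
    ultimately show ?thesis by (intro bexI[of _ z]) (auto intro: image_eqI)
  qed
  then obtain \<phi> where \<phi>: "\<And>b. b \<in> underS lam a \<Longrightarrow> \<phi> b \<in> L"
      "\<And>b x. b \<in> underS lam a \<Longrightarrow> x \<in> L \<Longrightarrow> (x, f b) \<in> lam \<Longrightarrow> G x b \<noteq> \<phi> b"
    by metis
  define \<psi> where "\<psi> b = (if b \<in> underS lam a then \<phi> b else undefined)" for b
  have "\<psi> \<in> ?F" using \<phi>(1) by (auto simp: Func_def \<psi>_def)
  then have "\<psi> \<in> G ` L" using G by simp
  then obtain x where x: "x \<in> L" "G x = \<psi>" by blast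
  obtain y where y: "y \<in> A" "(x, y) \<in> lam" using A(2)[OF x(1)] by blast
  then obtain b where "b \<in> underS lam a" "y = f b" using f(2) by blast
  then show False using \<phi>(2)[of b x] x y by (auto simp: \<psi>_def)
qed

text \<open>Cofinal subsets of \<open>lam\<close> have full size, so \<open>lam\<close> is regular;
  stability is the form of regularity that keeps small unions and products small.\<close>

lemma stable_lam: "stable lam"
proof (rule regularCard_stable[OF Card infL])
  show "regularCard lam"
    unfolding regularCard_def
  proof (intro allI impI)
    fix A assume A: "A \<subseteq> L \<and> cofinal A lam"
    then have "\<not> |A| <o lam" by (intro cofinal_not_small) (auto simp: cofinal_def)
    moreover have "|A| \<le>o lam"
      using A card_L card_of_mono1 ordLeq_ordIso_trans by blast
    ultimately show "|A| =o lam" using ordLeq_iff_ordLess_or_ordIso by blast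
  qed
qed

lemma small_UN: "|I| <o lam \<Longrightarrow> (\<And>i. i \<in> I \<Longrightarrow> |A i| <o lam) \<Longrightarrow> |\<Union>i\<in>I. A i| <o lam"
  by (rule stable_UNION[OF stable_lam])

lemma small_Times: "|A| <o lam \<Longrightarrow> |B| <o lam \<Longrightarrow> |A \<times> B| <o lam"
  by (rule stable_elim[OF stable_lam])

text \<open>Regularity gives \<open>lam \<le>o cf lam\<close>, so the segment below \<open>d\<close>
  has cofinality at least \<open>lam\<close> and the small set \<open>B\<close> cannot be cofinal in
  it.\<close>

lemma bounded_below_E_cof:
  assumes d: "d \<in> E_cof kap (cf lam)" and B: "B \<subseteq> underS kap d" "|B| <o lam"
  obtains x where "x \<in> underS kap d" "B \<subseteq> underS kap x"
proof -
  let ?R = "Restr kap (underS kap d)"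
  have Fld: "Field ?R = underS kap d"
    using wo_kap underS_Field by (intro Refl_Field_Restr2) (auto simp: order_on_defs)
  have "{A. A \<subseteq> L \<and> (\<forall>x\<in>L. \<exists>y\<in>A. (x, y) \<in> lam)} \<noteq> {}"
    using wo_lam by (auto simp: order_on_defs refl_on_def)
  from min_card(1)[OF this] obtain A where A: "A \<subseteq> L" "\<forall>x\<in>L. \<exists>y\<in>A. (x, y) \<in> lam" "cf lam = |A|"
    unfolding cf_def by blast
  have "\<not> |A| <o lam" using A by (intro cofinal_not_small) auto
  then have le: "lam \<le>o cf lam"
    using A(3) wo_lam card_of_Well_order not_ordLess_iff_ordLeq by metis
  have "\<not> (\<forall>x\<in>underS kap d. \<exists>y\<in>B. (x, y) \<in> ?R)"
  proof
    assume "\<forall>x\<in>underS kap d. \<exists>y\<in>B. (x, y) \<in> ?R"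
    then have mem: "B \<in> {A. A \<subseteq> Field ?R \<and> (\<forall>x\<in>Field ?R. \<exists>y\<in>A. (x, y) \<in> ?R)}"
      using B(1) unfolding Fld by blast
    then have "{A. A \<subseteq> Field ?R \<and> (\<forall>x\<in>Field ?R. \<exists>y\<in>A. (x, y) \<in> ?R)} \<noteq> {}" by (metis empty_iff)
    from min_card(2)[OF this mem] have "cf ?R \<le>o |B|" unfolding cf_def .
    then have "cf ?R <o lam" using B(2) ordLeq_ordLess_trans by blast
    moreover have "lam \<le>o cf ?R"
      using d le ordIso_symmetric ordLeq_ordIso_trans unfolding E_cof_def by blast
    ultimately show False using not_ordLess_ordLeq by blast
  qed
  then obtain x where x: "x \<in> underS kap d" "\<And>y. y \<in> B \<Longrightarrow> (x, y) \<notin> kap"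
    using B(1) by blast
  have "y \<in> underS kap x" if "y \<in> B" for y
    using x that B(1) Well_order_mem_iff[OF wo_kap, of x y] underS_in_Field(1) by (metis subsetD)
  then show ?thesis using that x(1) by blast
qed

text \<open>With \<open>g\<close> mapping \<open>lam\<close> onto \<open>B\<close>, every small
  subset is the image under \<open>g\<close> of the range of a function from an initial segment of
  \<open>lam\<close> to \<open>lam\<close>. The hypothesis on \<open>weak_power\<close> bounds the
  number of these functions.\<close>

lemma card_small_subsets_lam:
  assumes "|B| \<le>o lam" shows "|small_subsets lam B| \<le>o lam"
proof (cases "B = {}")
  case True
  then have "small_subsets lam B \<subseteq> {{}}" by (auto simp: small_subsets_def)
  then have "finite (small_subsets lam B)" using finite_subset by blast
  then show ?thesis by (intro small_imp_ordLeq finite_small)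
next
  case False
  have "|B| \<le>o |L|" using assms card_L ordIso_symmetric ordLeq_ordIso_trans by blast
  then obtain g where g: "g ` L = B" unfolding card_of_ordLeq2[OF False, symmetric] by blast
  let ?W = "SIGMA a:L. Func (underS lam a) L"
  have sub: "small_subsets lam B \<subseteq> (\<lambda>(a, v). g ` v ` underS lam a) ` ?W"
  proof
    fix S assume "S \<in> small_subsets lam B"
    then have S: "S \<subseteq> B" "|S| <o lam" by (auto simp: small_subsets_def)
    from S(2) obtain a f where a: "a \<in> L" and f: "f \<in> underS lam a \<rightarrow> S" "f ` underS lam a = S"
      by (rule small_subset_enumeration)
    define v where "v x = (if x \<in> underS lam a then inv_into L g (f x) else undefined)" for x
    have fB: "f x \<in> g ` L" if "x \<in> underS lam a" for x using that f(1) S(1) g by blast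
    have "v \<in> Func (underS lam a) L"
      using fB by (auto simp: Func_def v_def inv_into_into)
    moreover have "g ` v ` underS lam a = S"
      unfolding image_image f(2)[symmetric] using fB
      by (intro image_cong) (auto simp: v_def f_inv_into_f)
    ultimately show "S \<in> (\<lambda>(a, v). g ` v ` underS lam a) ` ?W"
      using a by (intro image_eqI[of _ _ "(a, v)"]) auto
  qed
  have "|?W| \<le>o lam"
    using wp unfolding weak_power_def by (rule ordIso_imp_ordLeq)
  then show ?thesis by (rule card_subset_ordLeq[OF sub card_image_ordLeq])
qed

text \<open>After embedding \<open>B\<close> into \<open>kap\<close>, every small subset is bounded.
  It therefore lies over one of the \<open>kap\<close> many initial segments, each of size at most
  \<open>lam\<close>.\<close>

lemma card_small_subsets_kap:
  assumes "|B| \<le>o kap" shows "|small_subsets lam B| \<le>o kap"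
proof -
  have "|B| \<le>o |K|" using assms card_K ordIso_symmetric ordLeq_ordIso_trans by blast
  then obtain e where e: "inj_on e B" "e ` B \<subseteq> K"
    unfolding card_of_ordLeq[symmetric] by blast
  have "small_subsets lam B \<subseteq> (\<Union>x\<in>K. small_subsets lam {b \<in> B. e b \<in> underS kap x})"
  proof
    fix S assume "S \<in> small_subsets lam B"
    then have S: "S \<subseteq> B" "|S| <o lam" by (auto simp: small_subsets_def)
    have "|e ` S| \<le>o lam" using S(2) card_image_ordLess small_imp_ordLeq by blast
    moreover have "e ` S \<subseteq> K" using S(1) e(2) by blast
    ultimately obtain x where "x \<in> K" "e ` S \<subseteq> underS kap x"
      using bounded_in_kap by blast
    then show "S \<in> (\<Union>x\<in>K. small_subsets lam {b \<in> B. e b \<in> underS kap x})"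
      using S by (auto simp: small_subsets_def)
  qed
  moreover have "|\<Union>x\<in>K. small_subsets lam {b \<in> B. e b \<in> underS kap x}| \<le>o kap"
  proof (rule ordLeq_kap_UN)
    show "|K| \<le>o kap" using card_K by (rule ordIso_imp_ordLeq)
    fix x assume "x \<in> K"
    have "inj_on e {b \<in> B. e b \<in> underS kap x}" using e(1) by (rule inj_on_subset) auto
    then have "|{b \<in> B. e b \<in> underS kap x}| \<le>o |underS kap x|"
      unfolding card_of_ordLeq[symmetric] by blast
    then have "|{b \<in> B. e b \<in> underS kap x}| \<le>o lam"
      using card_underS_kap ordLeq_transitive by blast
    then show "|small_subsets lam {b \<in> B. e b \<in> underS kap x}| \<le>o kap"
      using card_small_subsets_lam cardSuc_ordLeq[OF Card] ordLeq_transitive by blast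
  qed
  ultimately show ?thesis by (rule card_subset_ordLeq)
qed

end

section \<open>Posets of small approximations\<close>

text \<open>A clash between two constraints involves two pairs, that is, four elements. Testing only
  four elements at a time lets conditions pass to unions of chains and constraints pass to the union
  of a filter.\<close>

definition conds :: "'l rel \<Rightarrow> ('b \<Rightarrow> 'b \<Rightarrow> 'b \<Rightarrow> 'b \<Rightarrow> bool) \<Rightarrow> 'b set set" where
  "conds lam P = {f. |f| <o lam \<and> (\<forall>x\<in>f. \<forall>y\<in>f. \<forall>z\<in>f. \<forall>w\<in>f. P x y z w)}"

definition rev_incl :: "'b set set \<Rightarrow> 'b set rel" where
  "rev_incl Q = {(q, r). q \<in> Q \<and> r \<in> Q \<and> r \<subseteq> q}"

lemma conds_subset: "f \<in> conds lam P \<Longrightarrow> g \<subseteq> f \<Longrightarrow> g \<in> conds lam P"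
  unfolding conds_def using card_subset_ordLess[of g f lam] by blast

lemma compatible_conds_iff:
  assumes "q \<in> conds lam P" "r \<in> conds lam P"
  shows "compatible (conds lam P) (rev_incl (conds lam P)) q r \<longleftrightarrow> q \<union> r \<in> conds lam P"
proof
  assume "compatible (conds lam P) (rev_incl (conds lam P)) q r"
  then obtain s where "s \<in> conds lam P" "q \<union> r \<subseteq> s"
    unfolding compatible_def rev_incl_def by blast
  then show "q \<union> r \<in> conds lam P" by (rule conds_subset)
qed (use assms in \<open>auto simp: compatible_def rev_incl_def\<close>)

text \<open>Directedness collects the four elements in a single condition. This is how the
  four-place constraint is transferred to the generic object \<open>\<Union>G\<close>.\<close>

lemma filter_four:
  assumes "is_filter_in Q (rev_incl Q) G" and "{x, y, z, w} \<subseteq> \<Union>G"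
  obtains f where "f \<in> G" "{x, y, z, w} \<subseteq> f"
proof -
  have dir: "\<exists>h\<in>G. f \<union> g \<subseteq> h" if "f \<in> G" "g \<in> G" for f g
  proof -
    have "\<exists>h\<in>G. (h, f) \<in> rev_incl Q \<and> (h, g) \<in> rev_incl Q"
      using assms(1) that by (simp add: is_filter_in_def)
    then show ?thesis by (auto simp: rev_incl_def)
  qed
  have "\<exists>f\<in>G. {u, v} \<subseteq> f" if uv: "u \<in> \<Union>G" "v \<in> \<Union>G" for u v
  proof -
    obtain f g where fg: "f \<in> G" "u \<in> f" "g \<in> G" "v \<in> g" using uv by blast
    show ?thesis using dir[OF fg(1,3)] fg(2,4) by blast
  qed
  then obtain f g where fg: "f \<in> G" "{x, y} \<subseteq> f" "g \<in> G" "{z, w} \<subseteq> g"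
    using assms(2) by (metis insert_subset)
  obtain h where "h \<in> G" "f \<union> g \<subseteq> h" using dir[OF fg(1,3)] by blast
  then show ?thesis using fg by (intro that[of h]) auto
qed

context infinite_cardinal
begin

text \<open>A nonempty \<open>S\<close> is enumerated by \<open>kap\<close> with repetitions, which
  gives the indexed family that the axiom expects; for empty \<open>S\<close> the trivial dense set
  \<open>Q\<close> is used at every index.\<close>

lemma GMA_meets_dense:
  assumes gma: "GMA lam" and Q: "GMA_poset lam Q le"
    and S: "|S| \<le>o kap" "\<And>D. D \<in> S \<Longrightarrow> dense_in Q le D"
  obtains G where "is_filter_in Q le G" "\<And>D. D \<in> S \<Longrightarrow> G \<inter> D \<noteq> {}"
proof (cases "S = {}")
  case True
  have "dense_in Q le Q"
    using Q by (auto simp: GMA_poset_def dense_in_def order_on_defs refl_on_def)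
  then have "\<exists>G. is_filter_in Q le G \<and> (\<forall>\<alpha>\<in>K. G \<inter> Q \<noteq> {})"
    by (intro GMA_any_type[OF Card gma Q])
  then show ?thesis using that True by blast
next
  case False
  have "|S| \<le>o |K|" using S(1) card_K ordIso_symmetric ordLeq_ordIso_trans by blast
  then obtain g where g: "g ` K = S" unfolding card_of_ordLeq2[OF False, symmetric] by blast
  have "\<exists>G. is_filter_in Q le G \<and> (\<forall>\<alpha>\<in>K. G \<inter> g \<alpha> \<noteq> {})"
    using S(2) g by (intro GMA_any_type[OF Card gma Q]) auto
  then show ?thesis using that g by blast
qed

end

context weak_power_cardinal
begin

text \<open>Greatest lower bounds are unions. For a short decreasing sequence the union is small by
  regularity, and any four of its elements already occur together in one member of the
  sequence.\<close>

lemma GMA_poset_conds: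
  fixes P :: "'b \<Rightarrow> 'b \<Rightarrow> 'b \<Rightarrow> 'b \<Rightarrow> bool"
  defines "Q \<equiv> conds lam P"
  assumes size: "|Q| <o ctwo ^c lam" and scc: "stationary_cc lam Q (rev_incl Q)"
  shows "GMA_poset lam Q (rev_incl Q)"
  unfolding GMA_poset_def
proof (intro conjI ballI impI size scc)
  show "partial_order_on Q (rev_incl Q)"
    by (auto simp: order_on_defs rev_incl_def refl_on_def trans_def antisym_def)
  have "{} \<in> Q" using finite_small[of "{}"] by (auto simp: Q_def conds_def)
  then show "Q \<noteq> {}" by blast
next
  fix q r assume "q \<in> Q" "r \<in> Q" "compatible Q (rev_incl Q) q r"
  then have "q \<union> r \<in> Q" using compatible_conds_iff unfolding Q_def by blast
  then have "is_glb Q (rev_incl Q) {q, r} (q \<union> r)"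
    using \<open>q \<in> Q\<close> \<open>r \<in> Q\<close> by (auto simp: is_glb_def rev_incl_def)
  then show "\<exists>s. is_glb Q (rev_incl Q) {q, r} s" by blast
next
  fix \<sigma> q assume \<sigma>: "\<sigma> \<in> L" and q: "q \<in> underS lam \<sigma> \<rightarrow> Q"
    and dec: "\<forall>\<beta>\<in>underS lam \<sigma>. \<forall>\<alpha>\<in>underS lam \<beta>. (q \<beta>, q \<alpha>) \<in> rev_incl Q"
  let ?I = "underS lam \<sigma>"
  have dir: "\<exists>k\<in>?I. q i \<union> q j \<subseteq> q k" if "i \<in> ?I" "j \<in> ?I" for i j
  proof -
    have ij: "i \<in> L" "j \<in> L" using that by (auto dest: underS_in_Field(1))
    consider "i \<in> underS lam j" | "i = j" | "j \<in> underS lam i"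
      using underS_linear[OF wo_lam ij] by blast
    then show ?thesis
      using dec that unfolding rev_incl_def by cases blast+
  qed
  have "\<Union>(q ` ?I) \<in> Q"
    unfolding Q_def conds_def
  proof (intro CollectI conjI ballI)
    show "|\<Union>(q ` ?I)| <o lam"
      using q by (intro small_UN card_of_underS[OF Card \<sigma>]) (auto simp: Q_def conds_def)
    fix x y z w assume "x \<in> \<Union>(q ` ?I)" "y \<in> \<Union>(q ` ?I)" "z \<in> \<Union>(q ` ?I)" "w \<in> \<Union>(q ` ?I)"
    then obtain i j k l where i: "i \<in> ?I" "x \<in> q i" "j \<in> ?I" "y \<in> q j" "k \<in> ?I" "z \<in> q k"
      "l \<in> ?I" "w \<in> q l" by blast
    obtain m where m: "m \<in> ?I" "q i \<union> q j \<subseteq> q m" using dir i by blast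
    obtain n where n: "n \<in> ?I" "q k \<union> q l \<subseteq> q n" using dir i by blast
    obtain h where h: "h \<in> ?I" "q m \<union> q n \<subseteq> q h" using dir m n by blast
    have "q h \<in> conds lam P" using q h unfolding Q_def by blast
    moreover have "{x, y, z, w} \<subseteq> q h" using i m n h by blast
    ultimately show "P x y z w" by (simp add: conds_def)
  qed
  then have "is_glb Q (rev_incl Q) (q ` ?I) (\<Union>(q ` ?I))"
    using q by (auto simp: is_glb_def rev_incl_def)
  then show "\<exists>s. is_glb Q (rev_incl Q) (q ` ?I) s" by blast
qed

text \<open>Cohen forcing \<open>Add(lam, 1)\<close> has size \<open>lam\<close>, so if \<open>2\<^bsup>lam\<^esup> = lam\<^sup>+\<close> the axiom would yield
  a subset of \<open>lam\<close> different from every subset of \<open>lam\<close>.\<close>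

lemma GMA_imp_cardSuc_less:
  assumes gma: "GMA lam"
  shows "kap <o ctwo ^c lam"
proof (rule ccontr)
  assume "\<not> kap <o ctwo ^c lam"
  then have small: "ctwo ^c lam \<le>o kap"
    using not_ordLess_iff_ordLeq[OF _ wo_kap] Card_order_cexp card_order_on_well_order_on by blast
  define P :: "'a \<times> bool \<Rightarrow> 'a \<times> bool \<Rightarrow> 'a \<times> bool \<Rightarrow> 'a \<times> bool \<Rightarrow> bool"
    where "P = (\<lambda>x y _ _. fst x \<in> L \<and> (fst x = fst y \<longrightarrow> snd x = snd y))"
  define Q where "Q = conds lam P"
  have "Q \<subseteq> small_subsets lam (L \<times> (UNIV :: bool set))"
    by (auto simp: Q_def conds_def P_def small_subsets_def)
  moreover have "|small_subsets lam (L \<times> (UNIV :: bool set))| \<le>o lam"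
    using card_L finite_small[of "UNIV :: bool set"]
    by (intro card_small_subsets_lam card_of_Times_ordLeq_infinite_Field[OF infL _ _ Card])
      (auto intro: ordIso_imp_ordLeq small_imp_ordLeq)
  ultimately have Qlam: "|Q| \<le>o lam" by (rule card_subset_ordLeq)
  have "stationary_cc lam Q (rev_incl Q)"
    unfolding stationary_cc_def
  proof (intro ballI)
    let ?E = "E_cof kap (cf lam)"
    fix q assume q: "q \<in> K \<rightarrow> Q"
    \<comment> \<open>There are at most \<open>lam\<close> conditions, so a condition serves as its
      own code and any point below \<open>d\<close> serves as \<open>rho d\<close>.\<close>
    have "\<exists>x. x \<in> underS kap d" if "d \<in> ?E" for d
      by (rule bounded_below_E_cof[OF that, of "{}"]) (auto intro: finite_small)
    then obtain rho where rho: "\<And>d. d \<in> ?E \<Longrightarrow> rho d \<in> underS kap d" by metis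
    have qQ: "q d \<in> Q" if "d \<in> ?E" for d using q that by (auto simp: E_cof_def)
    obtain D h where D: "club kap D" "\<forall>d\<in>D \<inter> ?E. h d \<in> underS kap d"
      and h: "\<forall>g\<in>D \<inter> ?E. \<forall>d\<in>D \<inter> ?E. h g = h d \<longrightarrow> q g = q d"
      using regressive_coding[of "\<lambda>x. x" "\<lambda>_. Q" ?E rho q, OF _ Qlam rho qQ] by blast
    have "compatible Q (rev_incl Q) (q g) (q d)" if "g \<in> D \<inter> ?E" "d \<in> D \<inter> ?E" "h g = h d" for g d
    proof -
      have "q g = q d" "q d \<in> Q" using h that qQ by blast+
      then show ?thesis by (auto simp: compatible_def rev_incl_def)
    qed
    with D show "\<exists>D h. club kap D \<and> (\<forall>\<delta>\<in>D \<inter> ?E. h \<delta> \<in> underS kap \<delta>) \<and>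
        (\<forall>\<gamma>\<in>D \<inter> ?E. \<forall>\<delta>\<in>D \<inter> ?E. h \<gamma> = h \<delta> \<longrightarrow> compatible Q (rev_incl Q) (q \<gamma>) (q \<delta>))"
      by (intro exI[of _ D] exI[of _ h]) simp
  qed
  moreover have "|Q| <o ctwo ^c lam"
    using Qlam ordLess_ctwo_cexp[OF Card] ordLeq_ordLess_trans by blast
  ultimately have poset: "GMA_poset lam Q (rev_incl Q)"
    unfolding Q_def by (intro GMA_poset_conds)
  \<comment> \<open>These conditions already disagree with \<open>A\<close> at some
    \<open>x\<close>: the pair \<open>(x, True)\<close> decides that \<open>x\<close> belongs to the
    generic subset, and \<open>(x, False)\<close> that it does not.\<close>
  define E where "E A = {f \<in> Q. \<exists>x. (x, x \<notin> A) \<in> f}" for A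
  have dense: "dense_in Q (rev_incl Q) (E A)" for A
    unfolding dense_in_def
  proof (intro conjI ballI)
    fix f assume f: "f \<in> Q"
    then have "|fst ` f| <o lam" by (intro card_image_ordLess) (auto simp: Q_def conds_def)
    then obtain x where x: "x \<in> L" "x \<notin> fst ` f" using small_not_onto by blast
    let ?g = "f \<union> {(x, x \<notin> A)}"
    have "|?g| <o lam" using f finite_small by (intro small_Un) (auto simp: Q_def conds_def)
    then have "?g \<in> Q"
      using f x by (auto simp: Q_def conds_def P_def)
    then show "\<exists>d\<in>E A. (d, f) \<in> rev_incl Q"
      using f by (intro bexI[of _ ?g]) (auto simp: E_def rev_incl_def)
  qed (auto simp: E_def)
  have "|Pow L| =o ctwo ^c |L|"
    using card_of_Pow_Func[of L] unfolding cexp_def ctwo_def Field_card_of by simp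
  also have "ctwo ^c |L| =o ctwo ^c lam"
    using cexp_cong2[OF card_L ctwo_Cnotzero[THEN conjunct2]] Card card_of_Card_order by blast
  finally have "|E ` Pow L| \<le>o kap"
    by (intro card_image_ordLeq) (rule ordIso_ordLeq_trans[OF _ small])
  then obtain G where G: "is_filter_in Q (rev_incl Q) G" "\<And>D. D \<in> E ` Pow L \<Longrightarrow> G \<inter> D \<noteq> {}"
    using GMA_meets_dense[OF gma poset, of "E ` Pow L"] dense by blast
  \<comment> \<open>This is the generic subset itself. The filter meets \<open>E A\<close> for this
    very \<open>A\<close>, since \<open>2^lam\<close> was assumed to be at most \<open>kap\<close>
    and all subsets of \<open>lam\<close> were included.\<close>
  define A where "A = {x \<in> L. (x, True) \<in> \<Union>G}"
  have "G \<inter> E A \<noteq> {}" using G(2) by (auto simp: A_def)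
  then obtain f x where f: "f \<in> G" "f \<in> Q" "(x, x \<notin> A) \<in> f" unfolding E_def by blast
  then have xL: "x \<in> L" by (force simp: Q_def conds_def P_def)
  show False
  proof (cases "x \<in> A")
    case True
    then have "{(x, True), (x, False), (x, True), (x, True)} \<subseteq> \<Union>G"
      using f unfolding A_def by auto
    then obtain g where "g \<in> G" "{(x, True), (x, False), (x, True), (x, True)} \<subseteq> g"
      using filter_four[OF G(1)] by blast
    moreover then have "g \<in> Q" using G(1) by (auto simp: is_filter_in_def)
    ultimately show False by (force simp: Q_def conds_def P_def)
  next
    case False
    then show False using f xL unfolding A_def by auto
  qed
qed

end

section \<open>The homogenising poset\<close>

locale coloured_partition = weak_power_cardinal lam for lam :: "'a rel" +
  fixes p c :: "'a set \<times> 'a set \<Rightarrow> 'a"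
  assumes p_in: "p \<in> incr_pairs kap K \<rightarrow> L"
    and inj: "injective_fibers kap p"
    and ad: "almost_disjoint_fibers lam kap p"
    and c_in: "c \<in> incr_pairs kap K \<rightarrow> L"
begin

lemma p_L: "x \<in> underS kap y \<Longrightarrow> p (x, y) \<in> L"
  using p_in underS_in_Field by (fastforce simp: incr_pairs_def)

lemma c_L: "x \<in> underS kap y \<Longrightarrow> c (x, y) \<in> L"
  using c_in underS_in_Field by (fastforce simp: incr_pairs_def)

lemma fiber_inj: "inj_on (\<lambda>x. p (x, y)) (underS kap y)"
proof (rule inj_onI)
  fix u v assume uv: "u \<in> underS kap y" "v \<in> underS kap y" "p (u, y) = p (v, y)"
  note fld = underS_in_Field[OF uv(1)] underS_in_Field[OF uv(2)]
  from underS_linear[OF wo_kap fld(1,3)] show "u = v"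
    using inj fld uv unfolding injective_fibers_def by metis
qed

section \<open>Conditions and the constraints they impose\<close>

text \<open>A pair \<open>(x, i)\<close> promises that \<open>x\<close> goes into the
  \<open>i\<close>-th piece. Typing, single-valuedness and homogeneity of each piece are packed into
  one four-place predicate so that \<open>conds\<close> applies.\<close>

definition good :: "'a set \<times> 'a \<Rightarrow> 'a set \<times> 'a \<Rightarrow> 'a set \<times> 'a \<Rightarrow> 'a set \<times> 'a \<Rightarrow> bool" where
  "good x y z w \<longleftrightarrow> fst x \<in> K \<and> snd x \<in> L \<and> (fst x = fst y \<longrightarrow> snd x = snd y) \<and>
     (fst x \<in> underS kap (fst y) \<and> fst z \<in> underS kap (fst w) \<and>
      snd y = snd x \<and> snd z = snd x \<and> snd w = snd x \<and> p (fst x, fst y) = p (fst z, fst w) \<longrightarrow>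
      c (fst x, fst y) = c (fst z, fst w))"

abbreviation "Q \<equiv> conds lam good"

text \<open>The constraints a condition imposes: \<open>(i, v, w) \<in> trace f\<close> forces the witness for the
  \<open>i\<close>-th piece to map \<open>v\<close> to \<open>w\<close>.\<close>

definition trace :: "('a set \<times> 'a) set \<Rightarrow> ('a \<times> 'a \<times> 'a) set" where
  "trace f = {(i, p (x, y), c (x, y)) |i x y. (x, i) \<in> f \<and> (y, i) \<in> f \<and> x \<in> underS kap y}"

lemma traceI: "(x, i) \<in> f \<Longrightarrow> (y, i) \<in> f \<Longrightarrow> x \<in> underS kap y \<Longrightarrow> (i, p (x, y), c (x, y)) \<in> trace f"
  unfolding trace_def by blast

text \<open>Homogeneity of all pieces amounts to \<open>trace f\<close> being single-valued in its
  last coordinate; the extension and amalgamation arguments check this form.\<close>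

lemma Q_iff: "f \<in> Q \<longleftrightarrow> |f| <o lam \<and> f \<subseteq> K \<times> L \<and> (\<forall>x i j. (x, i) \<in> f \<longrightarrow> (x, j) \<in> f \<longrightarrow> i = j) \<and>
    (\<forall>i v w w'. (i, v, w) \<in> trace f \<longrightarrow> (i, v, w') \<in> trace f \<longrightarrow> w = w')"
  (is "_ \<longleftrightarrow> ?A \<and> ?B \<and> ?C \<and> ?D")
proof
  assume f: "f \<in> Q"
  then have g: "good x y z w" if "x \<in> f" "y \<in> f" "z \<in> f" "w \<in> f" for x y z w
    using that unfolding conds_def by blast
  have ?A using f unfolding conds_def by blast
  moreover have ?B using g unfolding good_def by fastforce
  moreover have ?C using g unfolding good_def by fastforce
  moreover have ?D
  proof (intro allI impI)
    fix i v w w' assume "(i, v, w) \<in> trace f" "(i, v, w') \<in> trace f"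
    then obtain x y x' y' where "(x, i) \<in> f" "(y, i) \<in> f" "x \<in> underS kap y" "(x', i) \<in> f" "(y', i) \<in> f"
      "x' \<in> underS kap y'" "v = p (x, y)" "w = c (x, y)" "v = p (x', y')" "w' = c (x', y')"
      unfolding trace_def by blast
    then show "w = w'" using g[of "(x, i)" "(y, i)" "(x', i)" "(y', i)"] unfolding good_def by simp
  qed
  ultimately show "?A \<and> ?B \<and> ?C \<and> ?D" by blast
next
  assume f: "?A \<and> ?B \<and> ?C \<and> ?D"
  have "good (x, i) (y, j) (z, k) (w, l)"
    if h: "(x, i) \<in> f" "(y, j) \<in> f" "(z, k) \<in> f" "(w, l) \<in> f" for x i y j z k w l
  proof -
    have "x \<in> K" "i \<in> L" using f h by auto
    moreover have "x = y \<longrightarrow> i = j" using f h by blast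
    moreover have "c (x, y) = c (z, w)"
      if "x \<in> underS kap y" "z \<in> underS kap w" "j = i" "k = i" "l = i" "p (x, y) = p (z, w)"
    proof -
      have "(i, p (x, y), c (x, y)) \<in> trace f" "(i, p (x, y), c (z, w)) \<in> trace f"
        using traceI[of x i f y] traceI[of z i f w] h that by auto
      then show ?thesis using f by blast
    qed
    ultimately show ?thesis unfolding good_def by simp
  qed
  then show "f \<in> Q" using f unfolding conds_def by auto
qed

lemma QD:
  assumes "f \<in> Q"
  shows "|f| <o lam" "f \<subseteq> K \<times> L" "(x, i) \<in> f \<Longrightarrow> (x, j) \<in> f \<Longrightarrow> i = j"
    "(i, v, w) \<in> trace f \<Longrightarrow> (i, v, w') \<in> trace f \<Longrightarrow> w = w'"
  using assms unfolding Q_iff by blast+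

lemma Domain_small: "f \<in> Q \<Longrightarrow> |Domain f| <o lam"
  unfolding Domain_fst by (intro card_image_ordLess QD(1))

text \<open>The trace is an image of part of \<open>f \<times> f\<close>, hence small. So there are
  at most \<open>lam\<close> possible traces, few enough for a trace to enter the code of a
  condition.\<close>

lemma trace_small: assumes "f \<in> Q" shows "trace f \<in> small_subsets lam (L \<times> L \<times> L)"
proof -
  have "trace f \<subseteq> (\<lambda>((x, i), (y, j)). (i, p (x, y), c (x, y))) ` (f \<times> f)"
  proof
    fix t assume "t \<in> trace f"
    then obtain i x y where t: "t = (i, p (x, y), c (x, y))" "(x, i) \<in> f" "(y, i) \<in> f"
      unfolding trace_def by blast
    then show "t \<in> (\<lambda>((x, i), (y, j)). (i, p (x, y), c (x, y))) ` (f \<times> f)"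
      by (intro image_eqI[of _ _ "((x, i), (y, i))"]) auto
  qed
  then have "|trace f| <o lam"
    by (rule card_subset_ordLess) (intro card_image_ordLess small_Times QD(1) assms)
  moreover have "trace f \<subseteq> L \<times> L \<times> L"
    using QD(2)[OF assms] p_L c_L unfolding trace_def by blast
  ultimately show ?thesis by (simp add: small_subsets_def)
qed

text \<open>The index of the piece is forgotten: avoiding \<open>vals f\<close> avoids clashes in
  every piece at once, and the set is still small.\<close>

definition vals :: "('a set \<times> 'a) set \<Rightarrow> 'a set" where
  "vals f = (\<lambda>(i, v, w). v) ` trace f"

lemma valsI: "(i, v, w) \<in> trace f \<Longrightarrow> v \<in> vals f"
  unfolding vals_def by force

lemma vals_small: "f \<in> Q \<Longrightarrow> |vals f| <o lam"
  unfolding vals_def using trace_small by (intro card_image_ordLess) (auto simp: small_subsets_def)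

lemma trace_insert:
  assumes "(j, v, w) \<in> trace (insert (b, i) f)" and "\<And>x. (x, i) \<in> f \<Longrightarrow> x \<in> underS kap b"
  shows "(j, v, w) \<in> trace f \<or> (\<exists>x. j = i \<and> (x, i) \<in> f \<and> v = p (x, b) \<and> w = c (x, b))"
proof -
  obtain x y where xy: "(x, j) \<in> insert (b, i) f" "(y, j) \<in> insert (b, i) f" "x \<in> underS kap y"
    "v = p (x, y)" "w = c (x, y)" using assms(1) unfolding trace_def by blast
  consider "(x, j) \<in> f" "(y, j) \<in> f" | "(x, j) \<in> f" "y = b" "j = i"
    | "x = b" "j = i" "(y, j) \<in> f" | "x = b" "y = b"
    using xy(1,2) by blast
  then show ?thesis
  proof cases
    case 1 then show ?thesis using xy traceI by blast
  next
    case 2 then show ?thesis using xy by blast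
  next
    case 3 then show ?thesis using xy(3) assms(2) underS_asym[OF wo_kap] by blast
  next
    case 4 then show ?thesis using xy(3) underS_notIn by fast
  qed
qed

text \<open>Every new pair has \<open>b\<close> as its upper point. The assumption
  \<open>new\<close> excludes clashes with old constraints, and injectivity of the fiber over
  \<open>b\<close> excludes clashes among the new ones.\<close>

lemma insert_in_Q:
  assumes f: "f \<in> Q" and b: "b \<in> K" "b \<notin> Domain f" and i: "i \<in> L"
    and below: "\<And>x. (x, i) \<in> f \<Longrightarrow> x \<in> underS kap b"
    and new: "\<And>x w. (x, i) \<in> f \<Longrightarrow> (i, p (x, b), w) \<notin> trace f"
  shows "insert (b, i) f \<in> Q"
  unfolding Q_iff
proof (intro conjI allI impI)
  show "|insert (b, i) f| <o lam"
    using small_Un[OF finite_small[of "{(b, i)}"] QD(1)[OF f]] by simp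
  show "insert (b, i) f \<subseteq> K \<times> L" using QD(2)[OF f] b i by blast
  show "j = k" if "(x, j) \<in> insert (b, i) f" "(x, k) \<in> insert (b, i) f" for x j k
    using that QD(3)[OF f] b(2) by blast
  fix j v w w'
  assume t: "(j, v, w) \<in> trace (insert (b, i) f)" "(j, v, w') \<in> trace (insert (b, i) f)"
  have split: "(j, v, w) \<in> trace f \<or> (\<exists>x. j = i \<and> (x, i) \<in> f \<and> v = p (x, b) \<and> w = c (x, b))"
    if "(j, v, w) \<in> trace (insert (b, i) f)" for w
    using that below by (rule trace_insert)
  from split[OF t(1)] split[OF t(2)] consider "(j, v, w) \<in> trace f" "(j, v, w') \<in> trace f"
    | x where "(j, v, w) \<in> trace f" "j = i" "(x, i) \<in> f" "v = p (x, b)"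
    | x where "(j, v, w') \<in> trace f" "j = i" "(x, i) \<in> f" "v = p (x, b)"
    | x x' where "(x, i) \<in> f" "v = p (x, b)" "w = c (x, b)" "(x', i) \<in> f" "v = p (x', b)" "w' = c (x', b)"
    by (elim disjE exE conjE) blast+
  then show "w = w'"
  proof cases
    case 1 then show ?thesis using QD(4)[OF f] by blast
  next
    case 2 then show ?thesis using new by blast
  next
    case 3 then show ?thesis using new by blast
  next
    case 4
    then have "x = x'" using inj_onD[OF fiber_inj[of b], of x x'] below by simp
    then show ?thesis using 4 by simp
  qed
qed

section \<open>The stationary chain condition\<close>

text \<open>A mixed pair with a point in the common root lies inside one of the conditions. In
  particular a lower point from \<open>g\<close> under an upper point from \<open>f\<close> is below
  \<open>del\<close>, hence in the root. Only pairs going from \<open>f\<close> outside the root up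
  to \<open>g\<close> outside the root are new.\<close>

lemma trace_cross:
  assumes g: "gam \<in> underS kap del" and sub: "Domain f \<subseteq> underS kap del"
    and root: "f \<inter> (underS kap gam \<times> UNIV) = g \<inter> (underS kap del \<times> UNIV)"
    and t: "(i, v, w) \<in> trace (f \<union> g)"
  shows "(i, v, w) \<in> trace f \<union> trace g \<or>
    (\<exists>x y. x \<in> Domain f \<and> x \<notin> underS kap gam \<and> y \<in> Domain g \<and> y \<notin> underS kap del \<and>
       x \<in> underS kap del \<and> v = p (x, y) \<and> w = c (x, y))"
proof -
  obtain x y where xy: "(x, i) \<in> f \<union> g" "(y, i) \<in> f \<union> g" "x \<in> underS kap y" "v = p (x, y)" "w = c (x, y)"
    using t unfolding trace_def by blast
  consider "(x, i) \<in> f" "(y, i) \<in> f" | "(x, i) \<in> g" "(y, i) \<in> g" | "(x, i) \<in> g" "(y, i) \<in> f"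
    | "(x, i) \<in> f" "(y, i) \<in> g" using xy(1,2) by blast
  then show ?thesis
  proof cases
    case 1 then show ?thesis using xy traceI by blast
  next
    case 2 then show ?thesis using xy traceI by blast
  next
    case 3
    then have "x \<in> underS kap del" using sub xy(3) underS_trans[OF wo_kap] by blast
    then have "(x, i) \<in> f" using 3 root by blast
    then show ?thesis using 3 xy traceI by blast
  next
    case 4
    show ?thesis
    proof (cases "x \<in> underS kap gam \<or> y \<in> underS kap del")
      case True
      then have "(x, i) \<in> g \<or> (y, i) \<in> f" using 4 root by blast
      then show ?thesis using 4 xy traceI by blast
    next
      case False
      then show ?thesis using 4 xy(4,5) sub by blast
    qed
  qed
qed

text \<open>The bound \<open>eta\<close> isolates the ordinals below \<open>del\<close> at which the fibers over \<open>Domain g\<close> repeat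
  an old value or meet each other, so pairs between the two conditions create no constraint that
  clashes with another one.\<close>

lemma amalgamation:
  assumes f: "f \<in> Q" and g: "g \<in> Q" and gd: "gam \<in> underS kap del" and sub: "Domain f \<subseteq> underS kap del"
    and root: "f \<inter> (underS kap gam \<times> UNIV) = g \<inter> (underS kap del \<times> UNIV)"
    and tr: "trace f = trace g" and eta: "eta \<in> underS kap gam"
    and old: "\<And>x y. x \<in> underS kap del \<Longrightarrow> y \<in> Domain g \<Longrightarrow> y \<notin> underS kap del \<Longrightarrow>
      p (x, y) \<in> vals g \<Longrightarrow> x \<in> underS kap eta"
    and meet: "\<And>x y x' y'. x \<in> underS kap del \<Longrightarrow> y \<in> Domain g \<Longrightarrow> y \<notin> underS kap del \<Longrightarrow>
      y' \<in> Domain g \<Longrightarrow> y \<in> underS kap y' \<Longrightarrow> x' \<in> underS kap y \<Longrightarrow> p (x, y) = p (x', y') \<Longrightarrow>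
      x \<in> underS kap eta"
  shows "f \<union> g \<in> Q"
  unfolding Q_iff
proof (intro conjI allI impI)
  show "|f \<union> g| <o lam" using QD(1)[OF f] QD(1)[OF g] by (rule small_Un)
  show "f \<union> g \<subseteq> K \<times> L" using QD(2)[OF f] QD(2)[OF g] by blast
  show "i = j" if ij: "(x, i) \<in> f \<union> g" "(x, j) \<in> f \<union> g" for x i j
  proof -
    have *: "k = l" if "(x, k) \<in> f" "(x, l) \<in> g" for k l
    proof -
      have "x \<in> underS kap del" using that sub by blast
      then have "(x, l) \<in> f" using that root by blast
      then show ?thesis using that QD(3)[OF f] by blast
    qed
    show ?thesis using ij * QD(3)[OF f] QD(3)[OF g] by blast
  qed
  define cross where "cross v w x y \<longleftrightarrow> x \<in> Domain f \<and> x \<notin> underS kap gam \<and> y \<in> Domain g \<and>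
    y \<notin> underS kap del \<and> x \<in> underS kap del \<and> v = p (x, y) \<and> w = c (x, y)" for v w x y
  have fld: "Domain f \<subseteq> K" "Domain g \<subseteq> K" using QD(2)[OF f] QD(2)[OF g] by blast+
  \<comment> \<open>Lower points of cross pairs are not below \<open>gam\<close>, hence not below
    \<open>eta\<close>, whereas \<open>old\<close> and \<open>meet\<close> place every offending
    lower point below \<open>eta\<close>.\<close>
  have not_eta: "x \<notin> underS kap eta" if "cross v w x y" for v w x y
    using that eta underS_trans[OF wo_kap] unfolding cross_def by blast
  have old': False if "cross v w x y" "(i, v, w') \<in> trace g" for v w w' x y i
    using old[of x y] not_eta[OF that(1)] that valsI unfolding cross_def by blast
  have meet': False if "cross v w x y" "cross v w' x' y'" "y \<in> underS kap y'" for v w w' x y x' y'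
  proof -
    have "del = y \<or> del \<in> underS kap y"
      using underS_linear[OF wo_kap, of y del] that(1) fld(2) underS_in_Field(2)[OF gd]
      unfolding cross_def by blast
    then have "x' \<in> underS kap y"
      using that(2) underS_trans[OF wo_kap] unfolding cross_def by blast
    then show False
      using meet[of x y y' x'] not_eta[OF that(1)] that unfolding cross_def by blast
  qed
  fix i v w w' assume t: "(i, v, w) \<in> trace (f \<union> g)" "(i, v, w') \<in> trace (f \<union> g)"
  have split: "(i, v, w) \<in> trace g \<or> (\<exists>x y. cross v w x y)"
    if "(i, v, w) \<in> trace (f \<union> g)" for v w
    using trace_cross[OF gd sub root that] tr unfolding cross_def by blast
  from split[OF t(1)] split[OF t(2)] consider "(i, v, w) \<in> trace g" "(i, v, w') \<in> trace g"
    | x y x' y' where "cross v w x y" "cross v w' x' y'"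
    using old' by blast
  then show "w = w'"
  proof cases
    case 1 then show ?thesis using QD(4)[OF g] by blast
  next
    \<comment> \<open>Two cross pairs with different upper points contradict \<open>meet'\<close> in
      one order or the other; with the same upper point, injectivity of its fiber identifies the
      lower points.\<close>
    case 2
    have yK: "y \<in> K" "y' \<in> K" using 2 fld(2) unfolding cross_def by blast+
    then have yy: "y = y'" using underS_linear[OF wo_kap yK] meet'[OF 2] meet'[OF 2(2,1)] by blast
    have "del = y \<or> del \<in> underS kap y"
      using underS_linear[OF wo_kap, of y del] 2(1) yK underS_in_Field(2)[OF gd]
      unfolding cross_def by blast
    then have "x \<in> underS kap y" "x' \<in> underS kap y"
      using 2 underS_trans[OF wo_kap] unfolding cross_def by blast+
    then have "x = x'"
      using inj_onD[OF fiber_inj[of y], of x x'] 2 yy unfolding cross_def by simp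
    then show ?thesis using 2 yy unfolding cross_def by simp
  qed
qed

text \<open>This bundles what \<open>amalgamation\<close> asks of \<open>eta\<close> with a bound on
  the root. It refers to one condition and its index only, so \<open>eta\<close> can be chosen
  before the partner condition is known.\<close>

definition isolates :: "('a set \<times> 'a) set \<Rightarrow> 'a set \<Rightarrow> 'a set \<Rightarrow> bool" where
  "isolates g d eta \<longleftrightarrow> Domain g \<inter> underS kap d \<subseteq> underS kap eta \<and>
    (\<forall>x y. x \<in> underS kap d \<longrightarrow> y \<in> Domain g \<longrightarrow> y \<notin> underS kap d \<longrightarrow>
      p (x, y) \<in> vals g \<longrightarrow> x \<in> underS kap eta) \<and>
    (\<forall>x y x' y'. x \<in> underS kap d \<longrightarrow> y \<in> Domain g \<longrightarrow> y \<notin> underS kap d \<longrightarrow>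
      y' \<in> Domain g \<longrightarrow> y \<in> underS kap y' \<longrightarrow> x' \<in> underS kap y \<longrightarrow> p (x, y) = p (x', y') \<longrightarrow>
      x \<in> underS kap eta)"

text \<open>The offenders \<open>A y\<close> inject into \<open>vals g\<close>, and the offenders
  \<open>M y y'\<close> inject into an intersection of two fibers, which is small by almost
  disjointness. Regularity keeps their union \<open>B\<close> small, and the cofinality of
  \<open>d\<close> bounds it.\<close>

lemma ex_isolating_bound:
  assumes d: "d \<in> E_cof kap (cf lam)" and g: "g \<in> Q"
  shows "\<exists>eta\<in>underS kap d. isolates g d eta"
proof -
  let ?U = "underS kap d"
  define A where "A y = {x \<in> ?U. p (x, y) \<in> vals g}" for y
  define M where "M y y' = {x \<in> ?U. p (x, y) \<in> {p (\<alpha>, y) |\<alpha>. \<alpha> \<in> underS kap y} \<inter>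
    {p (\<alpha>, y') |\<alpha>. \<alpha> \<in> underS kap y}}" for y y'
  define B where "B = (Domain g \<inter> ?U) \<union> (\<Union>y\<in>Domain g - ?U. A y) \<union>
    (\<Union>y\<in>Domain g - ?U. \<Union>y'\<in>{y' \<in> Domain g. y \<in> underS kap y'}. M y y')"
  have gK: "Domain g \<subseteq> K" using QD(2)[OF g] by blast
  have below: "?U \<subseteq> underS kap y" if "y \<in> Domain g - ?U" for y
  proof -
    have "y \<in> K" "d \<in> K" using that gK d by (auto simp: E_cof_def)
    then have "d = y \<or> d \<in> underS kap y" using underS_linear[OF wo_kap, of y d] that by blast
    then show ?thesis using underS_trans[OF wo_kap] by blast
  qed
  have inj': "inj_on (\<lambda>x. p (x, y)) S" if "y \<in> Domain g - ?U" "S \<subseteq> ?U" for y S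
    using fiber_inj[of y] below[OF that(1)] that(2) inj_on_subset by blast
  have Asm: "|A y| <o lam" if "y \<in> Domain g - ?U" for y
    by (rule card_inj_ordLess[OF inj'[OF that] _ vals_small[OF g]]) (auto simp: A_def)
  have Msm: "|M y y'| <o lam" if "y \<in> Domain g - ?U" "y' \<in> Domain g" "y \<in> underS kap y'" for y y'
  proof (rule card_inj_ordLess[OF inj'[OF that(1)]])
    show "|{p (\<alpha>, y) |\<alpha>. \<alpha> \<in> underS kap y} \<inter> {p (\<alpha>, y') |\<alpha>. \<alpha> \<in> underS kap y}| <o lam"
      using ad that gK unfolding almost_disjoint_fibers_def by blast
  qed (auto simp: M_def)
  have Dsm: "|S| <o lam" if "S \<subseteq> Domain g" for S
    using card_subset_ordLess[OF that Domain_small[OF g]] .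
  have "|B| <o lam"
    unfolding B_def by (intro small_Un small_UN Dsm Asm Msm) auto
  moreover have "B \<subseteq> ?U" unfolding B_def A_def M_def by blast
  ultimately obtain eta where eta: "eta \<in> ?U" "B \<subseteq> underS kap eta"
    using bounded_below_E_cof[OF d] by blast
  show ?thesis
    unfolding isolates_def
  proof (intro bexI[OF _ eta(1)] conjI allI impI)
    show "Domain g \<inter> ?U \<subseteq> underS kap eta" using eta(2) unfolding B_def by blast
    show "x \<in> underS kap eta"
      if "x \<in> ?U" "y \<in> Domain g" "y \<notin> ?U" "p (x, y) \<in> vals g" for x y
    proof -
      have "x \<in> A y" using that by (simp add: A_def)
      then show ?thesis using eta(2) that unfolding B_def by blast
    qed
    show "x \<in> underS kap eta"
      if "x \<in> ?U" "y \<in> Domain g" "y \<notin> ?U" "y' \<in> Domain g" "y \<in> underS kap y'" "x' \<in> underS kap y"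
        "p (x, y) = p (x', y')" for x y x' y'
    proof -
      have "x \<in> underS kap y" using below[of y] that by blast
      then have "x \<in> M y y'" unfolding M_def using that by blast
      then have "x \<in> (\<Union>y\<in>Domain g - ?U. \<Union>y'\<in>{y' \<in> Domain g. y \<in> underS kap y'}. M y y')"
        using that by (intro UN_I[of y] UN_I[of y']) auto
      then have "x \<in> B" unfolding B_def by (rule UnI2)
      then show ?thesis using eta(2) by blast
    qed
  qed
qed

text \<open>Each condition is coded by its root, its trace and its isolating bound. For fixed bound
  there are at most \<open>lam\<close> codes, so \<open>regressive_coding\<close> applies, and equal
  codes permit amalgamation.\<close>

lemma stationary_cc_Q: "stationary_cc lam Q (rev_incl Q)"
  unfolding stationary_cc_def
proof (intro ballI)
  let ?E = "E_cof kap (cf lam)"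
  fix q assume q: "q \<in> K \<rightarrow> Q"
  have qQ: "q d \<in> Q" if "d \<in> ?E" for d using q that by (auto simp: E_cof_def)
  have "\<exists>eta\<in>underS kap d. isolates (q d) d eta" if "d \<in> ?E" for d
    using ex_isolating_bound[OF that qQ[OF that]] .
  then obtain eta where eta: "\<And>d. d \<in> ?E \<Longrightarrow> eta d \<in> underS kap d"
    and iso: "\<And>d. d \<in> ?E \<Longrightarrow> isolates (q d) d (eta d)"
    by metis
  have "\<exists>y\<in>K. Domain (q x) \<subseteq> underS kap y" if "x \<in> K" for x
  proof -
    have "q x \<in> Q" using q that by blast
    then have "Domain (q x) \<subseteq> K" "|Domain (q x)| \<le>o lam"
      using QD(2) small_imp_ordLeq[OF Domain_small] by blast+
    then show ?thesis using bounded_in_kap by blast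
  qed
  then obtain F where F: "\<And>x. x \<in> K \<Longrightarrow> F x \<in> K" "\<And>x. x \<in> K \<Longrightarrow> Domain (q x) \<subseteq> underS kap (F x)"
    by metis
  \<comment> \<open>The component \<open>{x}\<close> records the bound itself, so that two
    conditions with the same code share \<open>eta\<close>, which then lies below the smaller index
    too.\<close>
  define C where "C x = small_subsets lam (underS kap x \<times> L) \<times> small_subsets lam (L \<times> L \<times> L) \<times> {x}" for x
  define co where "co d = (q d \<inter> (underS kap d \<times> UNIV), trace (q d), eta d)" for d
  have L: "|L| \<le>o lam" using card_L by (rule ordIso_imp_ordLeq)
  note times = card_of_Times_ordLeq_infinite_Field[OF infL _ _ Card]
  have Csm: "|C x| \<le>o lam" for x
    unfolding C_def
    by (intro times card_small_subsets_lam L card_underS_kap small_imp_ordLeq finite_small) simp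
  have coC: "co d \<in> C (eta d)" if "d \<in> ?E" for d
  proof -
    have "q d \<inter> (underS kap d \<times> UNIV) \<subseteq> underS kap (eta d) \<times> L"
      using iso[OF that] QD(2)[OF qQ[OF that]] unfolding isolates_def by blast
    moreover have "|q d \<inter> (underS kap d \<times> UNIV)| <o lam"
      by (rule card_subset_ordLess[OF _ QD(1)[OF qQ[OF that]]]) blast
    ultimately show ?thesis
      using trace_small[OF qQ[OF that]] unfolding C_def co_def by (simp add: small_subsets_def)
  qed
  obtain D h where D: "club kap D" "\<forall>d\<in>D. \<forall>x\<in>underS kap d. F x \<in> underS kap d"
    "\<forall>d\<in>D \<inter> ?E. h d \<in> underS kap d"
    "\<forall>g\<in>D \<inter> ?E. \<forall>d\<in>D \<inter> ?E. h g = h d \<longrightarrow> co g = co d"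
    using regressive_coding[of F C ?E eta co, OF F(1) Csm eta coC] by blast
  have less: "q g \<union> q d \<in> Q"
    if gd: "g \<in> D \<inter> ?E" "d \<in> D \<inter> ?E" "h g = h d" "g \<in> underS kap d" for g d
  proof (rule amalgamation[where eta = "eta d"])
    have "co g = co d" using D(4) gd by blast
    then have co: "q g \<inter> (underS kap g \<times> UNIV) = q d \<inter> (underS kap d \<times> UNIV)" "trace (q g) = trace (q d)"
      "eta g = eta d" by (simp_all add: co_def)
    show "q g \<inter> (underS kap g \<times> UNIV) = q d \<inter> (underS kap d \<times> UNIV)" "trace (q g) = trace (q d)"
      by (rule co)+
    show "q g \<in> Q" "q d \<in> Q" "g \<in> underS kap d" using gd qQ by blast+
    \<comment> \<open>Closure of the club under \<open>F\<close> is used here: the condition with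
      the smaller index lives entirely below the larger index.\<close>
    have "Domain (q g) \<subseteq> underS kap (F g)" using F(2) underS_in_Field(1)[OF gd(4)] .
    moreover have "F g \<in> underS kap d" using D(2) gd by blast
    ultimately show "Domain (q g) \<subseteq> underS kap d" using underS_trans[OF wo_kap] by blast
    show "eta d \<in> underS kap g" using eta[of g] gd(1) co(3) by simp
    have "isolates (q d) d (eta d)" using iso gd(2) by blast
    then show "x \<in> underS kap (eta d)"
      if "x \<in> underS kap d" "y \<in> Domain (q d)" "y \<notin> underS kap d" "p (x, y) \<in> vals (q d)" for x y
      using that unfolding isolates_def by blast
    show "x \<in> underS kap (eta d)"
      if "x \<in> underS kap d" "y \<in> Domain (q d)" "y \<notin> underS kap d" "y' \<in> Domain (q d)"
        "y \<in> underS kap y'" "x' \<in> underS kap y" "p (x, y) = p (x', y')" for x y x' y'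
      using that \<open>isolates (q d) d (eta d)\<close> unfolding isolates_def by blast
  qed
  have "compatible Q (rev_incl Q) (q g) (q d)"
    if gd: "g \<in> D \<inter> ?E" "d \<in> D \<inter> ?E" "h g = h d" for g d
  proof -
    have "g \<in> K" "d \<in> K" "q g \<in> Q" "q d \<in> Q" using gd qQ by (auto simp: E_cof_def)
    moreover from this have "q g \<union> q d \<in> Q"
      using underS_linear[OF wo_kap, of g d] less[OF gd] less[OF gd(2,1) gd(3)[symmetric]]
      by (auto simp: Un_commute)
    ultimately show ?thesis by (simp add: compatible_conds_iff)
  qed
  with D show "\<exists>D h. club kap D \<and> (\<forall>\<delta>\<in>D \<inter> ?E. h \<delta> \<in> underS kap \<delta>) \<and>
      (\<forall>\<gamma>\<in>D \<inter> ?E. \<forall>\<delta>\<in>D \<inter> ?E. h \<gamma> = h \<delta> \<longrightarrow> compatible Q (rev_incl Q) (q \<gamma>) (q \<delta>))"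
    by (intro exI[of _ D] exI[of _ h]) simp
qed

lemma card_Q: "|Q| \<le>o kap"
proof (rule card_subset_ordLeq)
  show "Q \<subseteq> small_subsets lam (K \<times> L)"
    using QD(1,2) unfolding small_subsets_def by blast
  have "|L| \<le>o kap"
    using card_L cardSuc_ordLeq[OF Card] ordIso_ordLeq_trans by blast
  then show "|small_subsets lam (K \<times> L)| \<le>o kap"
    using card_K by (intro card_small_subsets_kap card_of_Times_ordLeq_infinite_Field[OF infK _ _ Card_kap])
      (rule ordIso_imp_ordLeq)
qed

lemma GMA_poset_Q: "GMA lam \<Longrightarrow> GMA_poset lam Q (rev_incl Q)"
  by (intro GMA_poset_conds stationary_cc_Q ordLeq_ordLess_trans[OF card_Q GMA_imp_cardSuc_less])

section \<open>Density arguments\<close>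

lemma dense_in_Q:
  assumes "\<And>f. f \<in> Q \<Longrightarrow> \<exists>g\<in>Q. f \<subseteq> g \<and> R g"
  shows "dense_in Q (rev_incl Q) {f \<in> Q. R f}"
  unfolding dense_in_def
proof (intro conjI ballI)
  fix f assume f: "f \<in> Q"
  from assms[OF this] obtain g where "g \<in> Q" "f \<subseteq> g" "R g" by blast
  with f show "\<exists>d\<in>{f \<in> Q. R f}. (d, f) \<in> rev_incl Q"
    by (intro bexI[of _ g]) (auto simp: rev_incl_def)
qed blast

lemma extend_domain:
  assumes f: "f \<in> Q" and b: "b \<in> K"
  shows "\<exists>g\<in>Q. f \<subseteq> g \<and> b \<in> Domain g"
proof (cases "b \<in> Domain f")
  case False
  have "|Range f| <o lam" unfolding Range_snd by (intro card_image_ordLess QD(1) f)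
  then obtain i where i: "i \<in> L" "i \<notin> Range f" using small_not_onto by blast
  then have "insert (b, i) f \<in> Q" by (intro insert_in_Q f b False) auto
  then show ?thesis by (intro bexI[of _ "insert (b, i) f"]) auto
qed (use f in blast)

lemma inj_avoiding:
  assumes "|a| <o lam" "|V| <o lam"
  obtains g where "inj_on g a" "g ` a \<subseteq> L - V"
proof -
  have "\<not> |L - V| <o lam"
  proof
    assume "|L - V| <o lam"
    then have "|(L - V) \<union> V| <o lam" using assms(2) by (rule small_Un)
    then obtain x where "x \<in> L" "x \<notin> (L - V) \<union> V" by (rule small_not_onto)
    then show False by blast
  qed
  then have "lam \<le>o |L - V|"
    using not_ordLess_iff_ordLeq[OF wo_lam card_of_Well_order] by blast
  then have "|a| \<le>o |L - V|"
    using small_imp_ordLeq[OF assms(1)] ordLeq_transitive by blast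
  then show ?thesis using that unfolding card_of_ordLeq[symmetric] by blast
qed

text \<open>Values are prescribed on the whole domain of \<open>f\<close>, not only on its
  \<open>i\<close>-th piece. The point \<open>b\<close> supplied by the Cohen property is therefore
  above the entire domain and outside it.\<close>

lemma extend_Cohen:
  assumes Cohen: "Cohen_fibers lam kap lam p" and f: "f \<in> Q" and i: "i \<in> L" and y: "y \<in> K"
    and g: "g \<in> Domain f \<rightarrow> L" "inj_on g (Domain f)"
    and new: "\<And>x w. (x, i) \<in> f \<Longrightarrow> (i, g x, w) \<notin> trace f"
  shows "\<exists>b. (y, b) \<in> kap \<and> insert (b, i) f \<in> Q \<and> (\<forall>x\<in>Domain f. x \<in> underS kap b \<and> p (x, b) = g x)"
proof -
  have "Domain f \<subseteq> K" using QD(2)[OF f] by blast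
  then obtain b where b: "b \<in> K" "(y, b) \<in> kap"
      "\<And>x. x \<in> Domain f \<Longrightarrow> x \<in> underS kap b \<and> g x = p (x, b)"
    using Cohen[unfolded Cohen_fibers_def, rule_format, of "Domain f" g y] Domain_small[OF f] g y by blast
  have "insert (b, i) f \<in> Q"
  proof (rule insert_in_Q[OF f b(1) _ i])
    show "b \<notin> Domain f" using b(3)[of b] underS_notIn by fast
    show "x \<in> underS kap b" if "(x, i) \<in> f" for x using b(3) that by blast
    show "(i, p (x, b), w) \<notin> trace f" if "(x, i) \<in> f" for x w
      using b(3)[of x] new[OF that] that by (metis DomainI)
  qed
  then show ?thesis using b by (intro exI[of _ b]) simp
qed

text \<open>Injectively prescribed values outside \<open>vals f\<close> meet no existing constraint,
  so the new point can join the \<open>i\<close>-th piece.\<close>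

lemma extend_unbounded:
  assumes Cohen: "Cohen_fibers lam kap lam p" and f: "f \<in> Q" and i: "i \<in> L" and y: "y \<in> K"
  shows "\<exists>g\<in>Q. f \<subseteq> g \<and> (\<exists>b. (b, i) \<in> g \<and> (y, b) \<in> kap)"
proof -
  obtain g where g: "inj_on g (Domain f)" "g ` Domain f \<subseteq> L - vals f"
    using inj_avoiding[OF Domain_small[OF f] vals_small[OF f]] by blast
  have "\<exists>b. (y, b) \<in> kap \<and> insert (b, i) f \<in> Q \<and> (\<forall>x\<in>Domain f. x \<in> underS kap b \<and> p (x, b) = g x)"
  proof (rule extend_Cohen[OF Cohen f i y _ g(1)])
    show "g \<in> Domain f \<rightarrow> L" using g(2) by blast
    show "(i, g x, w) \<notin> trace f" if "(x, i) \<in> f" for x w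
      using g(2) valsI[of i "g x" w f] that by blast
  qed
  then show ?thesis by blast
qed

text \<open>First some \<open>a\<close> is put into the \<open>i\<close>-th piece. Unless
  \<open>v\<close> is already attained there, a new upper point with value \<open>v\<close> at
  \<open>a\<close> and fresh values elsewhere attains it.\<close>

lemma extend_value:
  assumes Cohen: "Cohen_fibers lam kap lam p" and f: "f \<in> Q" and i: "i \<in> L" and v: "v \<in> L"
  shows "\<exists>g\<in>Q. f \<subseteq> g \<and> (\<exists>x y. (x, i) \<in> g \<and> (y, i) \<in> g \<and> x \<in> underS kap y \<and> p (x, y) = v)"
proof -
  obtain y where y: "y \<in> K" using infK by fastforce
  obtain h a where h: "h \<in> Q" "f \<subseteq> h" "(a, i) \<in> h"
    using extend_unbounded[OF Cohen f i y] by blast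
  show ?thesis
  proof (cases "\<exists>w. (i, v, w) \<in> trace h")
    case True
    then show ?thesis using h unfolding trace_def by blast
  next
    case False
    \<comment> \<open>The value \<open>v\<close> is avoided as well, so that changing
      \<open>g\<close> at \<open>a\<close> to \<open>v\<close> keeps it injective.\<close>
    have "|vals h \<union> {v}| <o lam" by (intro small_Un vals_small h(1) finite_small) simp
    then obtain g where g: "inj_on g (Domain h)" "g ` Domain h \<subseteq> L - (vals h \<union> {v})"
      using inj_avoiding[OF Domain_small[OF h(1)]] by blast
    then have gx: "g x \<in> L" "g x \<notin> vals h" "g x \<noteq> v" if "x \<in> Domain h" for x
      using that by blast+
    have "\<exists>b. (y, b) \<in> kap \<and> insert (b, i) h \<in> Q \<and>
      (\<forall>x\<in>Domain h. x \<in> underS kap b \<and> p (x, b) = (g(a := v)) x)"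
    proof (rule extend_Cohen[OF Cohen h(1) i y, of "g(a := v)"])
      show "g(a := v) \<in> Domain h \<rightarrow> L" using gx(1) v by (simp add: Pi_iff)
      show "inj_on (g(a := v)) (Domain h)" using g(1) gx(3) by (intro inj_on_fun_updI) auto
      show "(i, (g(a := v)) x, w) \<notin> trace h" if "(x, i) \<in> h" for x w
        using gx(2)[OF DomainI[OF that]] False valsI[of i "g x" w h] by auto
    qed
    then obtain b where b: "insert (b, i) h \<in> Q"
        "\<forall>x\<in>Domain h. x \<in> underS kap b \<and> p (x, b) = (g(a := v)) x"
      by blast
    have "p (a, b) = v" "a \<in> underS kap b" using bspec[OF b(2) DomainI[OF h(3)]] by auto
    then show ?thesis using b(1) h by (intro bexI[of _ "insert (b, i) h"]) blast+
  qed
qed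

section \<open>The generic decomposition\<close>

lemma decomposition:
  assumes gma: "GMA lam"
  shows "\<exists>X. disjoint_family_on X L \<and> (\<Union>i\<in>L. X i) = K \<and>
    (\<forall>i\<in>L. homogeneous kap lam lam p c (X i) \<and>
      (Cohen_fibers lam kap lam p \<longrightarrow> |X i| =o kap \<and> p ` incr_pairs kap (X i) = L))"
proof -
  let ?Co = "Cohen_fibers lam kap lam p"
  define DA where "DA b = {f \<in> Q. b \<in> Domain f}" for b
  define DB where "DB = (\<lambda>(i, y). {f \<in> Q. \<exists>b. (b, i) \<in> f \<and> (y, b) \<in> kap})"
  define DC where "DC = (\<lambda>(i, v). {f \<in> Q. \<exists>x y. (x, i) \<in> f \<and> (y, i) \<in> f \<and> x \<in> underS kap y \<and> p (x, y) = v})"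
  \<comment> \<open>\<open>DA\<close> makes the pieces cover \<open>kap\<close>, \<open>DB\<close>
    makes each of them unbounded and \<open>DC\<close> makes each attain every value. The last two
    are included only with Cohen fibers, on which their density rests.\<close>
  define S where "S = DA ` K \<union> (if ?Co then DB ` (L \<times> K) \<union> DC ` (L \<times> L) else {})"
  have L: "|L| \<le>o kap" using card_L cardSuc_ordLeq[OF Card] ordIso_ordLeq_trans by blast
  have K: "|K| \<le>o kap" using card_K by (rule ordIso_imp_ordLeq)
  have "|DA ` K \<union> (DB ` (L \<times> K) \<union> DC ` (L \<times> L))| \<le>o kap"
    by (intro card_of_Un_ordLeq_infinite_Field[OF infK _ _ Card_kap] card_image_ordLeq
        card_of_Times_ordLeq_infinite_Field[OF infK _ _ Card_kap] L K)
  then have S: "|S| \<le>o kap"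
    by (rule card_subset_ordLeq[rotated]) (auto simp: S_def)
  have "dense_in Q (rev_incl Q) (DA b)" if "b \<in> K" for b
    unfolding DA_def using that by (intro dense_in_Q extend_domain)
  moreover have "dense_in Q (rev_incl Q) (DB (i, y))" if "?Co" "i \<in> L" "y \<in> K" for i y
    unfolding DB_def prod.case using that by (intro dense_in_Q extend_unbounded)
  moreover have "dense_in Q (rev_incl Q) (DC (i, v))" if "?Co" "i \<in> L" "v \<in> L" for i v
    unfolding DC_def prod.case using that by (intro dense_in_Q extend_value)
  ultimately have "dense_in Q (rev_incl Q) D" if "D \<in> S" for D
    using that unfolding S_def by (auto split: if_splits)
  then obtain G where G: "is_filter_in Q (rev_incl Q) G" "\<And>D. D \<in> S \<Longrightarrow> G \<inter> D \<noteq> {}"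
    using GMA_meets_dense[OF gma GMA_poset_Q[OF gma] S] by blast
  have GQ: "G \<subseteq> Q" using G(1) by (simp add: is_filter_in_def)
  have four: "\<exists>f\<in>Q. {x, y, z, w} \<subseteq> f" if "{x, y, z, w} \<subseteq> \<Union>G" for x y z w
    by (rule filter_four[OF G(1) that]) (use GQ in blast)
  define X where "X i = {b. (b, i) \<in> \<Union>G}" for i
  have XK: "X i \<subseteq> K" for i
    using GQ QD(2) unfolding X_def by blast
  have "disjoint_family_on X L"
    unfolding disjoint_family_on_def
  proof (intro ballI impI equals0I)
    fix i j b assume "i \<noteq> j" and b: "b \<in> X i \<inter> X j"
    then have "{(b, i), (b, j), (b, i), (b, i)} \<subseteq> \<Union>G" unfolding X_def by blast
    from four[OF this] obtain f where "f \<in> Q" "(b, i) \<in> f" "(b, j) \<in> f" by blast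
    then show False using QD(3) \<open>i \<noteq> j\<close> by blast
  qed
  moreover have "(\<Union>i\<in>L. X i) = K"
  proof
    show "(\<Union>i\<in>L. X i) \<subseteq> K" using XK by blast
    show "K \<subseteq> (\<Union>i\<in>L. X i)"
    proof
      fix b assume "b \<in> K"
      then have "DA b \<in> S" by (simp add: S_def)
      then obtain f where "f \<in> G" "f \<in> Q" "b \<in> Domain f" using G(2) unfolding DA_def by blast
      then obtain i where "(b, i) \<in> f" "i \<in> L" using QD(2)[OF \<open>f \<in> Q\<close>] by blast
      then show "b \<in> (\<Union>i\<in>L. X i)" using \<open>f \<in> G\<close> unfolding X_def by blast
    qed
  qed
  moreover have "homogeneous kap lam lam p c (X i)" for i
  proof -
    \<comment> \<open>The witness function must send all of \<open>lam\<close> into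
      \<open>lam\<close>, so a value \<open>v\<close> not attained on the piece receives an
      arbitrary colour.\<close>
    have "\<exists>w\<in>L. \<forall>x y. (x, y) \<in> incr_pairs kap (X i) \<and> p (x, y) = v \<longrightarrow> c (x, y) = w" for v
    proof (cases "\<exists>x y. (x, y) \<in> incr_pairs kap (X i) \<and> p (x, y) = v")
      case True
      then obtain x y where xy: "x \<in> X i" "y \<in> X i" "x \<in> underS kap y" "p (x, y) = v"
        unfolding incr_pairs_def by blast
      have "c (x', y') = c (x, y)"
        if "x' \<in> X i" "y' \<in> X i" "x' \<in> underS kap y'" "p (x', y') = v" for x' y'
      proof -
        have "{(x, i), (y, i), (x', i), (y', i)} \<subseteq> \<Union>G" using xy(1,2) that(1,2) unfolding X_def by blast
        from four[OF this] obtain f where f: "f \<in> Q" "(x, i) \<in> f" "(y, i) \<in> f" "(x', i) \<in> f" "(y', i) \<in> f"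
          by blast
        then show ?thesis
          using QD(4)[OF f(1), of i v] traceI[OF f(2,3) xy(3)] traceI[OF f(4,5) that(3)] xy(4) that(4)
          by simp
      qed
      then show ?thesis using c_L[OF xy(3)] unfolding incr_pairs_def by blast
    next
      case False
      have "L \<noteq> {}" using infL by auto
      then show ?thesis using False by blast
    qed
    then obtain \<tau> where \<tau>: "\<And>v. \<tau> v \<in> L"
        "\<And>v x y. (x, y) \<in> incr_pairs kap (X i) \<Longrightarrow> p (x, y) = v \<Longrightarrow> c (x, y) = \<tau> v"
      by metis
    then show ?thesis using XK unfolding homogeneous_def by (intro conjI bexI[of _ \<tau>]) auto
  qed
  moreover have "|X i| =o kap" if Co: "?Co" and i: "i \<in> L" for i
  proof -
    \<comment> \<open>A piece of size at most \<open>lam\<close> would lie below some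
      \<open>y\<close>, contrary to the point at or above \<open>y\<close> that
      \<open>DB (i, y)\<close> supplies.\<close>
    have "\<not> |X i| \<le>o lam"
    proof
      assume "|X i| \<le>o lam"
      with XK obtain y where y: "y \<in> K" "X i \<subseteq> underS kap y" by (rule bounded_in_kap)
      then have "DB (i, y) \<in> S" using i Co by (simp add: S_def)
      then obtain f b where "f \<in> G" "(b, i) \<in> f" "(y, b) \<in> kap" using G(2) unfolding DB_def by blast
      then have "b \<in> underS kap y" "(y, b) \<in> kap" using y(2) unfolding X_def by blast+
      then show False using Well_order_mem_iff[OF wo_kap y(1)] underS_in_Field(1) by metis
    qed
    then have "\<not> |X i| <o kap" using cardSuc_ordLeq_ordLess[OF Card card_of_Card_order] by blast
    moreover have "|X i| \<le>o kap" using card_subset_ordLeq[OF XK K] .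
    ultimately show ?thesis using ordLeq_iff_ordLess_or_ordIso by blast
  qed
  moreover have "p ` incr_pairs kap (X i) = L" if Co: "?Co" and i: "i \<in> L" for i
  proof
    show "p ` incr_pairs kap (X i) \<subseteq> L" using p_L unfolding incr_pairs_def by blast
    show "L \<subseteq> p ` incr_pairs kap (X i)"
    proof
      fix v assume "v \<in> L"
      then have "DC (i, v) \<in> S" using i Co by (simp add: S_def)
      then obtain f x y where f: "f \<in> G" "(x, i) \<in> f" "(y, i) \<in> f" "x \<in> underS kap y" "p (x, y) = v"
        using G(2) unfolding DC_def by blast
      then have "(x, y) \<in> incr_pairs kap (X i)" unfolding incr_pairs_def X_def by blast
      then show "v \<in> p ` incr_pairs kap (X i)" using f(5) by blast
    qed
  qed
  ultimately show ?thesis by (intro exI[of _ X]) simp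
qed

end

theorem theorem3p5:
  fixes lam :: "'a rel"
    and p :: "'a set \<times> 'a set \<Rightarrow> 'a"
  assumes "Card_order lam" and "cinfinite lam"
    and "weak_power lam =o lam"
    and "GMA lam"
    and "p \<in> incr_pairs (cardSuc lam) (Field (cardSuc lam)) \<rightarrow> Field lam"
    and "injective_fibers (cardSuc lam) p"
    and "almost_disjoint_fibers lam (cardSuc lam) p"
  shows "(\<forall>c \<in> incr_pairs (cardSuc lam) (Field (cardSuc lam)) \<rightarrow> Field lam.
           \<exists>X :: 'a \<Rightarrow> 'a set set.
             disjoint_family_on X (Field lam) \<and>
             (\<Union>i\<in>Field lam. X i) = Field (cardSuc lam) \<and>
             (\<forall>i\<in>Field lam.
                homogeneous (cardSuc lam) lam lam p c (X i) \<and>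
                (Cohen_fibers lam (cardSuc lam) lam p \<longrightarrow>
                   |X i| =o cardSuc lam \<and> p ` incr_pairs (cardSuc lam) (X i) = Field lam))) \<and>
         (\<forall>c \<in> incr_pairs (cardSuc lam) (Field (cardSuc lam)) \<rightarrow> Field lam.
           z_num (cardSuc lam) lam lam p c \<le>o lam)"
proof -
  have dec: "\<exists>X :: 'a \<Rightarrow> 'a set set.
             disjoint_family_on X (Field lam) \<and>
             (\<Union>i\<in>Field lam. X i) = Field (cardSuc lam) \<and>
             (\<forall>i\<in>Field lam.
                homogeneous (cardSuc lam) lam lam p c (X i) \<and>
                (Cohen_fibers lam (cardSuc lam) lam p \<longrightarrow>
                   |X i| =o cardSuc lam \<and> p ` incr_pairs (cardSuc lam) (X i) = Field lam))"
    if "c \<in> incr_pairs (cardSuc lam) (Field (cardSuc lam)) \<rightarrow> Field lam" for c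
  proof -
    interpret coloured_partition lam p c
      by unfold_locales (fact assms that)+
    show ?thesis using assms(4) by (rule decomposition)
  qed
  have z: "z_num (cardSuc lam) lam lam p c \<le>o lam"
    if c: "c \<in> incr_pairs (cardSuc lam) (Field (cardSuc lam)) \<rightarrow> Field lam" for c
  proof -
    obtain X where X: "(\<Union>i\<in>Field lam. X i) = Field (cardSuc lam)"
        "\<forall>i\<in>Field lam. homogeneous (cardSuc lam) lam lam p c (X i)"
      using dec[OF c] by (elim exE conjE) (rule that, simp, blast)
    let ?S = "{\<A>. (\<forall>A\<in>\<A>. homogeneous (cardSuc lam) lam lam p c A) \<and> \<Union>\<A> = Field (cardSuc lam)}"
    \<comment> \<open>The pieces themselves are a homogeneous cover indexed by \<open>lam\<close>,
      which bounds the minimum from above.\<close>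
    have mem: "X ` Field lam \<in> ?S" using X by simp
    then have "?S \<noteq> {}" by (metis empty_iff)
    from min_card(2)[OF this mem] have "z_num (cardSuc lam) lam lam p c \<le>o |X ` Field lam|"
      unfolding z_num_def .
    also have "|X ` Field lam| \<le>o lam"
      using card_of_Field_ordIso[OF assms(1)] by (intro card_image_ordLeq ordIso_imp_ordLeq)
    finally show ?thesis .
  qed
  show ?thesis by (intro conjI ballI dec z)
qed

end
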